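(* Let $\mathcal{H}$ be a finite-dimensional complex Hilbert space, $\mathcal{V}$ a compact subgroup of the unitary group $\mathcal{U}(\mathcal{H})$ with normalized Haar measure $\mu_{\mathcal{V}}$, and consider the channel $$\Phi^*_{\mathcal{V}}:\mathcal{S}(\mathcal{H})\to\mathcal{S}(\mathcal{H}),\qquad \rho\mapsto\int_{\mathcal{V}}V\rho V^\dagger\,d\mu_{\mathcal{V}}(V).$$ Let $(m_1,\dots,m_k)$ and $(d_1,\dots,d_k)$ be the multiplicities and dimensions of the irreducible representations in the decomposition of $\mathcal{H}$ under $\mathcal{V}$. Then the dual $E^*_{\mathcal{V}}$ of the conditional expectation $E_{\mathcal{V}}$ onto the commutant $\mathcal{V}'$ satisfies $$C_{\mathrm{EA}}(E^*_{\mathcal{V}})\le\log\Big(\sum_{i=1}^k m_i^2\Big).$$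
   Context: $\mathcal{S}(\mathcal{H})$ denotes density operators; $\log$ is base 2. $\mathcal{V}'=\{X\in\mathcal{B}(\mathcal{H}):XV=VX\ \forall V\in\mathcal{V}\}$. $E_{\mathcal{V}}$ is the ergodic projection $\lim_N\frac1N\sum_{t=0}^{N-1}\Phi_{\mathcal{V}}^{\circ t}$ of the (Heisenberg-picture) group average $\Phi_{\mathcal{V}}$, the dual of $\Phi_{\mathcal{V}}^*$; it is a conditional expectation onto $\mathcal{V}'=\mathrm{Fix}(\Phi_{\mathcal{V}})$. Duals are with respect to the Hilbert–Schmidt pairing, $\mathrm{tr}[E^*(\rho)a]=\mathrm{tr}[\rho E(a)]$. The entanglement-assisted classical capacity of a channel $\mathcal{N}$ on $\mathcal{B}(\mathcal{H}_A)$ is $C_{\mathrm{EA}}(\mathcal{N})=\max_{\rho_A\in\mathcal{S}(\mathcal{H}_A)}I(R:A)_{(\mathrm{id}_R\otimes\mathcal{N})(\psi_{RA})}$, where $\psi_{RA}$ is any purification of $\rho_A$ and $I(R:A)_\sigma=D(\sigma_{RA}\Vert\sigma_R\otimes\sigma_A)$. *)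

theory Defs
  imports "HOL-Analysis.Analysis" "HOL-Probability.Probability"
begin

section \<open>Operators on a finite-dimensional Hilbert space\<close>

text \<open>
  The Hilbert space is \<^typ>\<open>complex^'n\<close> with its standard inner product, and its operators are
  the square complex matrices.  Complex-linear notions are those of the interpretation
  \<^verbatim>\<open>vec\<close> (scalar multiplication by complex numbers), whereas the
  norm, topology and Bochner integral come from the underlying real normed space.
\<close>

definition cinner :: "complex^'n \<Rightarrow> complex^'n \<Rightarrow> complex" where
  "cinner x y = (\<Sum>i\<in>UNIV. cnj (x $ i) * y $ i)"

definition dagger :: "complex^'n^'n \<Rightarrow> complex^'n^'n" where
  "dagger A = map_matrix cnj (transpose A)"

definition hermitian :: "complex^'n^'n \<Rightarrow> bool" where
  "hermitian A \<longleftrightarrow> dagger A = A"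

definition unitary :: "complex^'n^'n \<Rightarrow> bool" where
  "unitary U \<longleftrightarrow> dagger U ** U = mat 1 \<and> U ** dagger U = mat 1"

definition positive_semidefinite :: "complex^'n^'n \<Rightarrow> bool" where
  "positive_semidefinite A \<longleftrightarrow> hermitian A \<and> (\<forall>x. 0 \<le> Re (cinner x (A *v x)))"

definition density_operator :: "complex^'n^'n \<Rightarrow> bool" where
  "density_operator \<rho> \<longleftrightarrow> positive_semidefinite \<rho> \<and> trace \<rho> = 1"

text \<open>
  The bilinear pairing of \<open>\<rho>\<close> and \<open>a\<close> given by the trace of \<open>\<rho>a\<close> is nondegenerate, so there is at
  most one \<open>S\<close> as below; it exists whenever \<open>T\<close> is complex linear.  The defining relation is
  symmetric in \<open>S\<close> and \<open>T\<close>, so this is used both for passing to the Heisenberg picture and back.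
\<close>

definition hs_dual ::
  "(complex^'n^'n \<Rightarrow> complex^'n^'n) \<Rightarrow> complex^'n^'n \<Rightarrow> complex^'n^'n" where
  "hs_dual T = (THE S. \<forall>\<rho> a. trace (S \<rho> ** a) = trace (\<rho> ** T a))"


section \<open>Group averages and the ergodic projection\<close>

definition compact_unitary_group :: "(complex^'n^'n) set \<Rightarrow> bool" where
  "compact_unitary_group G \<longleftrightarrow>
     compact G \<and> (\<forall>U\<in>G. unitary U) \<and> mat 1 \<in> G \<and>
     (\<forall>U\<in>G. \<forall>W\<in>G. U ** W \<in> G) \<and> (\<forall>U\<in>G. dagger U \<in> G)"

text \<open>
  Left translations are homeomorphisms of \<open>G\<close>, hence measurable, so the last condition is
  invariance of the measure of Borel sets under left translation.  Right invariance follows,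
  \<open>G\<close> being compact, and regularity is automatic, \<open>G\<close> being metrizable.
\<close>

definition normalized_haar_measure ::
  "(complex^'n^'n) set \<Rightarrow> (complex^'n^'n) measure \<Rightarrow> bool" where
  "normalized_haar_measure G \<mu> \<longleftrightarrow>
     prob_space \<mu> \<and> sets \<mu> = sets (restrict_space borel G) \<and>
     (\<forall>U\<in>G. distr \<mu> \<mu> (\<lambda>W. U ** W) = \<mu>)"

text \<open>The state-picture average, extended linearly from states to all operators.\<close>

definition group_channel ::
  "(complex^'n^'n) measure \<Rightarrow> complex^'n^'n \<Rightarrow> complex^'n^'n" where
  "group_channel \<mu> \<rho> = integral\<^sup>L \<mu> (\<lambda>U. U ** \<rho> ** dagger U)"

definition ergodic_projection ::
  "(complex^'n^'n \<Rightarrow> complex^'n^'n) \<Rightarrow> complex^'n^'n \<Rightarrow> complex^'n^'n" where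
  "ergodic_projection T X = lim (\<lambda>N::nat. (1 / real N) *\<^sub>R (\<Sum>t<N. (T ^^ t) X))"

text \<open>
  For the Haar measure on \<open>G\<close>, the fixed points of the Heisenberg-picture average are the operators
  commuting with every element of \<open>G\<close>, and its ergodic projection is the conditional expectation
  onto this commutant.
\<close>

definition conditional_expectation_onto_commutant ::
  "(complex^'n^'n) measure \<Rightarrow> complex^'n^'n \<Rightarrow> complex^'n^'n" where
  "conditional_expectation_onto_commutant \<mu> = ergodic_projection (hs_dual (group_channel \<mu>))"


section \<open>Decomposition into irreducible representations\<close>

definition invariant_subspace :: "(complex^'n^'n) set \<Rightarrow> (complex^'n) set \<Rightarrow> bool" where
  "invariant_subspace G W \<longleftrightarrow> vec.subspace W \<and> (\<forall>U\<in>G. \<forall>x\<in>W. U *v x \<in> W)"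

definition irreducible_subspace :: "(complex^'n^'n) set \<Rightarrow> (complex^'n) set \<Rightarrow> bool" where
  "irreducible_subspace G W \<longleftrightarrow>
     invariant_subspace G W \<and> W \<noteq> {0} \<and>
     (\<forall>S. invariant_subspace G S \<and> S \<subseteq> W \<longrightarrow> S = {0} \<or> S = W)"

text \<open>
  Every linear map from \<open>W\<close> to \<open>W'\<close> extends to the whole space, so intertwiners may be given by
  matrices.
\<close>

definition equivalent_reps ::
  "(complex^'n^'n) set \<Rightarrow> (complex^'n) set \<Rightarrow> (complex^'n) set \<Rightarrow> bool" where
  "equivalent_reps G W W' \<longleftrightarrow>
     (\<exists>T :: complex^'n^'n. bij_betw (\<lambda>x. T *v x) W W' \<and>
        (\<forall>U\<in>G. \<forall>x\<in>W. T *v (U *v x) = U *v (T *v x)))"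

text \<open>
  The space is the orthogonal direct sum of irreducible subspaces \<open>W i j\<close> for \<open>i = 1, \<dots>, k\<close> and
  \<open>j = 1, \<dots>, m i\<close>, where \<open>i\<close> labels the equivalence class.  Every class \<open>i\<close> does occur
  (\<open>m i \<ge> 1\<close>).
\<close>

definition irrep_decomposition ::
  "(complex^'n^'n) set \<Rightarrow> nat \<Rightarrow> (nat \<Rightarrow> nat) \<Rightarrow> (nat \<Rightarrow> nat) \<Rightarrow> bool" where
  "irrep_decomposition G k m d \<longleftrightarrow>
     (\<forall>i\<in>{1..k}. 1 \<le> m i) \<and>
     (\<exists>W :: nat \<Rightarrow> nat \<Rightarrow> (complex^'n) set.
        (\<forall>i\<in>{1..k}. \<forall>j\<in>{1..m i}. irreducible_subspace G (W i j) \<and> vec.dim (W i j) = d i) \<and>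
        (\<forall>i\<in>{1..k}. \<forall>j\<in>{1..m i}. \<forall>i'\<in>{1..k}. \<forall>j'\<in>{1..m i'}.
           equivalent_reps G (W i j) (W i' j') \<longleftrightarrow> i = i') \<and>
        (\<forall>i\<in>{1..k}. \<forall>j\<in>{1..m i}. \<forall>i'\<in>{1..k}. \<forall>j'\<in>{1..m i'}.
           (i, j) \<noteq> (i', j') \<longrightarrow> (\<forall>x\<in>W i j. \<forall>y\<in>W i' j'. cinner x y = 0)) \<and>
        vec.span (\<Union>i\<in>{1..k}. \<Union>j\<in>{1..m i}. W i j) = UNIV)"


section \<open>Logarithm of a positive operator and relative entropy\<close>

definition eigenspace :: "complex^'n^'n \<Rightarrow> real \<Rightarrow> (complex^'n) set" where
  "eigenspace A l = {v. A *v v = complex_of_real l *s v}"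

definition orthogonal_projection :: "(complex^'n) set \<Rightarrow> complex^'n^'n" where
  "orthogonal_projection S = (THE P. hermitian P \<and> P ** P = P \<and> range (\<lambda>x. P *v x) = S)"

text \<open>
  Base-2 logarithm of a positive semidefinite operator by spectral calculus, taken to be zero on
  the kernel.
\<close>

definition mat_log2 :: "complex^'n^'n \<Rightarrow> complex^'n^'n" where
  "mat_log2 A =
     (\<Sum>l\<in>{l. l \<noteq> 0 \<and> eigenspace A l \<noteq> {0}}. log 2 l *\<^sub>R orthogonal_projection (eigenspace A l))"

text \<open>The support of a Hermitian operator is its range.\<close>

definition relative_entropy :: "complex^'n^'n \<Rightarrow> complex^'n^'n \<Rightarrow> ereal" where
  "relative_entropy \<rho> \<sigma> =
     (if range (\<lambda>x. \<rho> *v x) \<subseteq> range (\<lambda>x. \<sigma> *v x)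
      then ereal (Re (trace (\<rho> ** (mat_log2 \<rho> - mat_log2 \<sigma>)))) else \<infinity>)"


section \<open>Bipartite systems and entanglement-assisted capacity\<close>

text \<open>
  The tensor product of \<^typ>\<open>complex^'r\<close> and \<^typ>\<open>complex^'n\<close> is \<^typ>\<open>complex^('r \<times> 'n)\<close>; the
  first factor is the reference system \<open>R\<close>, the second one is \<open>A\<close>.
\<close>

definition tensor_op ::
  "complex^'r^'r \<Rightarrow> complex^'n^'n \<Rightarrow> complex^('r::finite \<times> 'n::finite)^('r::finite \<times> 'n::finite)" where
  "tensor_op X Y = (\<chi> p q. X $ fst p $ fst q * Y $ snd p $ snd q)"

definition reduced_R :: "complex^('r::finite \<times> 'n::finite)^('r::finite \<times> 'n::finite) \<Rightarrow> complex^'r^'r" where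
  "reduced_R X = (\<chi> r s. \<Sum>a\<in>UNIV. X $ (r, a) $ (s, a))"

definition reduced_A :: "complex^('r::finite \<times> 'n::finite)^('r::finite \<times> 'n::finite) \<Rightarrow> complex^'n^'n" where
  "reduced_A X = (\<chi> a b. \<Sum>r\<in>UNIV. X $ (r, a) $ (r, b))"

text \<open>For linear \<open>N\<close>, the tensor product of the identity on \<open>R\<close> with \<open>N\<close>: apply \<open>N\<close> to each block.\<close>

definition id_tensor ::
  "(complex^'n^'n \<Rightarrow> complex^'n^'n) \<Rightarrow>
     complex^('r::finite \<times> 'n::finite)^('r::finite \<times> 'n::finite) \<Rightarrow> complex^('r::finite \<times> 'n::finite)^('r::finite \<times> 'n::finite)" where
  "id_tensor N X = (\<chi> p q. N (\<chi> a b. X $ (fst p, a) $ (fst q, b)) $ snd p $ snd q)"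

definition pure_state :: "complex^'m \<Rightarrow> complex^'m^'m" where
  "pure_state \<psi> = (\<chi> i j. \<psi> $ i * cnj (\<psi> $ j))"

definition purification :: "complex^('r::finite \<times> 'n::finite) \<Rightarrow> complex^'n^'n \<Rightarrow> bool" where
  "purification \<psi> \<rho> \<longleftrightarrow> reduced_A (pure_state \<psi>) = \<rho>"

definition mutual_information :: "complex^('r::finite \<times> 'n::finite)^('r::finite \<times> 'n::finite) \<Rightarrow> ereal" where
  "mutual_information \<sigma> = relative_entropy \<sigma> (tensor_op (reduced_R \<sigma>) (reduced_A \<sigma>))"

text \<open>
  The first argument fixes the reference system.  All purifications of a state with that
  reference system give the same mutual information, and every state on \<open>A\<close> has one as soon as the
  dimension of \<open>R\<close> is at least that of \<open>A\<close>; the value is then independent of the choice of \<open>R\<close>.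
\<close>

definition ea_capacity ::
  "'r::finite itself \<Rightarrow> (complex^'n^'n \<Rightarrow> complex^'n^'n) \<Rightarrow> ereal" where
  "ea_capacity R N =
     Sup {mutual_information (id_tensor N (pure_state \<psi>)) | (\<rho> :: complex^'n^'n)
            (\<psi> :: complex^('r \<times> 'n)). density_operator \<rho> \<and> purification \<psi> \<rho>}"

end

theory Submission
  imports Defs
begin

text \<open>
  The averaged channel \<open>\<Phi>\<close> is its own ergodic projection up to taking duals, and it is the
  Hilbert--Schmidt orthogonal projection onto the commutant \<open>\<V>'\<close>:
  \<open>\<Phi>(\<rho>) = \<Sum>\<^sub>X tr(X\<^sup>\<dagger>\<rho>) X\<close> for an orthonormal basis \<open>B\<close> of \<open>\<V>'\<close>.  By Schur's lemma \<open>M = |B|\<close>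
  is at most \<open>\<Sum>\<^sub>i m\<^sub>i\<^sup>2\<close>.  The operator \<open>T = \<Sum>\<^sub>X X X\<^sup>\<dagger>\<close> is positive, invertible and commutes with \<open>\<V>'\<close>,
  and \<open>\<tau> = T/M\<close> is a state.

  Let \<open>\<sigma> = (id \<otimes> \<Phi>)(\<psi>\<psi>\<^sup>\<dagger>)\<close>.  Klein's inequality for \<open>\<sigma>\<^sub>A\<close> and \<open>\<tau>\<close> gives
  \<open>I(R:A) = D(\<sigma> \<parallel> \<sigma>\<^sub>R \<otimes> \<sigma>\<^sub>A) \<le> D(\<sigma> \<parallel> \<sigma>\<^sub>R \<otimes> \<tau>)\<close>, and the bound by the order-2 quantity reduces
  the claim to \<open>tr(\<sigma>\<^sup>2 (\<sigma>\<^sub>R \<otimes> T)\<^sup>-\<^sup>1) \<le> 1\<close>.  For an eigenvector \<open>e\<close> of \<open>\<sigma>\<^sub>R\<close> the vector \<open>\<sigma>(e \<otimes> g)\<close> is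
  linear in \<open>h = \<Psi>\<^sup>\<dagger>e\<close>, where \<open>\<Psi>\<close> is \<open>\<psi>\<close> read as a matrix; these \<open>h\<close> are orthogonal with squared
  norms the eigenvalues of \<open>\<sigma>\<^sub>R\<close>, so Bessel's inequality bounds the left side by
  \<open>\<Sum>\<^sub>X\<^sub>Y tr(\<rho> Y X\<^sup>\<dagger>) tr(Y\<^sup>\<dagger> X T\<^sup>-\<^sup>1) = tr(\<Phi>(\<rho>) T T\<^sup>-\<^sup>1) = 1\<close>.
\<close>

section \<open>Matrices and the inner product\<close>

lemma cinner_add_left: "cinner (x + y) z = cinner x z + cinner y z"
  by (simp add: cinner_def sum.distrib algebra_simps)

lemma cinner_add_right: "cinner x (y + z) = cinner x y + cinner x z"
  by (simp add: cinner_def sum.distrib algebra_simps)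

lemma cinner_diff_right: "cinner x (y - z) = cinner x y - cinner x z"
  by (simp add: cinner_def sum_subtractf algebra_simps)

lemma cinner_diff_left: "cinner (x - y) z = cinner x z - cinner y z"
  by (simp add: cinner_def sum_subtractf algebra_simps)

lemma cinner_scale_left: "cinner (c *s x) y = cnj c * cinner x y"
  by (simp add: cinner_def sum_distrib_left algebra_simps)

lemma cinner_scale_right: "cinner x (c *s y) = c * cinner x y"
  by (simp add: cinner_def sum_distrib_left algebra_simps)

lemma cinner_zero_left [simp]: "cinner 0 y = 0"
  by (simp add: cinner_def)

lemma cinner_zero_right [simp]: "cinner x 0 = 0"
  by (simp add: cinner_def)

lemma cinner_sum_left: "cinner (\<Sum>i\<in>I. f i) y = (\<Sum>i\<in>I. cinner (f i) y)"
  by (induction I rule: infinite_finite_induct) (simp_all add: cinner_add_left)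

lemma cinner_sum_right: "cinner x (\<Sum>i\<in>I. f i) = (\<Sum>i\<in>I. cinner x (f i))"
  by (induction I rule: infinite_finite_induct) (simp_all add: cinner_add_right)

lemma cnj_cinner: "cnj (cinner x y) = cinner y x"
  by (simp add: cinner_def mult.commute)

lemma cinner_self: "cinner x x = of_real ((norm x)\<^sup>2)"
proof -
  have "(norm x)\<^sup>2 = (\<Sum>i\<in>UNIV. (cmod (x $ i))\<^sup>2)"
    by (simp add: norm_vec_def L2_set_def sum_nonneg)
  then show ?thesis
    by (simp add: cinner_def mult.commute[of "cnj _"] complex_norm_square[symmetric]
        del: complex_norm_square)
qed

lemma cinner_self_eq_0_iff [simp]: "cinner x x = 0 \<longleftrightarrow> x = 0"
  by (simp add: cinner_self)

lemma cinner_mult_cnj: "cinner x y * cinner y x = of_real ((cmod (cinner x y))\<^sup>2)"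
  using complex_norm_square[of "cinner x y"] by (simp add: cnj_cinner)

lemma dagger_nth [simp]: "dagger A $ i $ j = cnj (A $ j $ i)"
  by (simp add: dagger_def transpose_def)

lemma cinner_matrix_right: "cinner x (A *v y) = cinner (dagger A *v x) y"
proof -
  have "cinner x (A *v y) = (\<Sum>i\<in>UNIV. \<Sum>j\<in>UNIV. cnj (x $ i) * (A $ i $ j * y $ j))"
    by (simp add: cinner_def matrix_vector_mult_def sum_distrib_left)
  also have "\<dots> = (\<Sum>j\<in>UNIV. \<Sum>i\<in>UNIV. cnj (x $ i) * (A $ i $ j * y $ j))"
    by (rule sum.swap)
  also have "\<dots> = cinner (dagger A *v x) y"
    by (simp add: cinner_def matrix_vector_mult_def sum_distrib_left sum_distrib_right algebra_simps)
  finally show ?thesis .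
qed

lemma dagger_dagger [simp]: "dagger (dagger A) = A"
  by (simp add: vec_eq_iff)

lemma cinner_matrix_left: "cinner (A *v x) y = cinner x (dagger A *v y)"
  by (simp add: cinner_matrix_right)

lemma dagger_mult: "dagger (A ** B) = dagger B ** dagger A"
  by (simp add: vec_eq_iff matrix_matrix_mult_def mult.commute)

lemma dagger_mat_1 [simp]: "dagger (mat 1) = mat 1"
  by (simp add: vec_eq_iff mat_def)

lemma dagger_add: "dagger (A + B) = dagger A + dagger B"
  by (simp add: vec_eq_iff)

lemma dagger_zero [simp]: "dagger 0 = 0"
  by (simp add: vec_eq_iff)

lemma dagger_sum: "dagger (\<Sum>i\<in>I. f i) = (\<Sum>i\<in>I. dagger (f i))"
  by (induction I rule: infinite_finite_induct) (simp_all add: dagger_add)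

lemma trace_dagger: "trace (dagger A) = cnj (trace A)"
  by (simp add: trace_def)

lemma hermitian_cinner: "hermitian A \<Longrightarrow> cinner x (A *v y) = cinner (A *v x) y"
  by (simp add: cinner_matrix_right hermitian_def)

lemma hermitian_quadratic_real: "hermitian A \<Longrightarrow> cinner x (A *v x) = of_real (Re (cinner x (A *v x)))"
  using cnj_cinner[of x "A *v x"] hermitian_cinner[of A x x]
  by (metis Reals_cnj_iff of_real_Re)

lemma matrix_sum_vector_mult: "(\<Sum>i\<in>I. f i) *v x = (\<Sum>i\<in>I. f i *v x)"
  for f :: "'i \<Rightarrow> complex^'n^'m"
  by (induction I rule: infinite_finite_induct) (simp_all add: matrix_vector_mult_add_rdistrib)

lemma matrix_vector_mult_sum: "A *v (\<Sum>i\<in>I. f i) = (\<Sum>i\<in>I. A *v f i)"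
  for A :: "complex^'n^'m"
  by (induction I rule: infinite_finite_induct) (simp_all add: matrix_vector_right_distrib)

lemma matrix_add_rdistrib: "(A + B) ** C = A ** C + B ** C"
  for A B :: "'a::semiring_1^'n^'m"
  by (simp add: vec_eq_iff matrix_matrix_mult_def sum.distrib distrib_right)

lemma sum_matrix_mult: "(\<Sum>i\<in>I. f i) ** A = (\<Sum>i\<in>I. f i ** A)"
  for A :: "complex^'n^'m"
  by (induction I rule: infinite_finite_induct) (simp_all add: matrix_add_rdistrib)

lemma matrix_mult_sum: "A ** (\<Sum>i\<in>I. f i) = (\<Sum>i\<in>I. A ** f i)"
  for A :: "complex^'n^'m"
  by (induction I rule: infinite_finite_induct) (simp_all add: matrix_add_ldistrib)

lemma trace_sum: "trace (\<Sum>i\<in>I. f i) = (\<Sum>i\<in>I. trace (f i))"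
  for f :: "'i \<Rightarrow> complex^'n^'n"
  by (induction I rule: infinite_finite_induct) (simp_all add: trace_add trace_0[unfolded mat_0])

text \<open>\<open>*\<^sub>R\<close> scales a matrix only by reals, and for a matrix the scalars of
  \<open>*s\<close> have the type of a row, so complex multiples are defined entrywise.\<close>

definition cscale :: "complex \<Rightarrow> complex^'n^'m \<Rightarrow> complex^'n^'m" where
  "cscale c A = (\<chi> i j. c * A $ i $ j)"

lemma cscale_nth [simp]: "cscale c A $ i $ j = c * A $ i $ j"
  by (simp add: cscale_def)

lemma cscale_mult_left: "cscale c A ** B = cscale c (A ** B)"
  by (simp add: vec_eq_iff matrix_matrix_mult_def sum_distrib_left mult.assoc)

lemma cscale_mult_right: "A ** cscale c B = cscale c (A ** B)"
  by (simp add: vec_eq_iff matrix_matrix_mult_def sum_distrib_left mult.left_commute)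

lemma cscale_vector_mult: "cscale c A *v x = c *s (A *v x)"
  by (simp add: vec_eq_iff matrix_vector_mult_def sum_distrib_left mult.assoc)

lemma cscale_cscale: "cscale c (cscale c' A) = cscale (c * c') A"
  by (simp add: vec_eq_iff mult.assoc)

lemma dagger_cscale: "dagger (cscale c A) = cscale (cnj c) (dagger A)"
  by (simp add: vec_eq_iff)

lemma trace_cscale: "trace (cscale c A) = c * trace A"
  by (simp add: trace_def sum_distrib_left)

lemma cscale_1 [simp]: "cscale 1 A = A"
  by (simp add: vec_eq_iff)

lemma cscale_zero [simp]: "cscale c 0 = 0" "cscale 0 A = 0"
  by (simp_all add: vec_eq_iff)

section \<open>Orthonormal systems and the spectral theorem\<close>

definition orthonormal_set :: "(complex^'n) set \<Rightarrow> bool" where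
  "orthonormal_set B \<longleftrightarrow> (\<forall>x\<in>B. \<forall>y\<in>B. cinner x y = of_bool (x = y))"

text \<open>The equality is turned round so that sums over the second argument match
  \<open>sum_mult_of_bool_eq\<close>.\<close>

lemma orthonormal_setD:
  "orthonormal_set B \<Longrightarrow> x \<in> B \<Longrightarrow> y \<in> B \<Longrightarrow> cinner x y = of_bool (y = x)"
  unfolding orthonormal_set_def by (cases "x = y") auto

lemma orthonormal_set_independent:
  assumes "orthonormal_set B" shows "vec.independent B"
  unfolding vec.independent_explicit_module
proof (intro allI impI)
  fix t u v
  assume t: "finite t" "t \<subseteq> B" and z: "(\<Sum>w\<in>t. u w *s w) = 0" and v: "v \<in> t"
  have "cinner v w = of_bool (w = v)" if "w \<in> t" for w
    using orthonormal_setD[OF assms] t v that by blast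
  then have "cinner v (\<Sum>w\<in>t. u w *s w) = (\<Sum>w\<in>t. u w * of_bool (w = v))"
    by (simp add: cinner_sum_right cinner_scale_right)
  also have "\<dots> = u v" using t v by (simp add: sum_mult_of_bool_eq)
  finally show "u v = 0" using z by simp
qed

lemma orthonormal_set_finite:
  assumes "orthonormal_set (B :: (complex^'n) set)"
  shows "finite B" "card B \<le> CARD('n)"
  using vec.independent_bound_general[OF orthonormal_set_independent[OF assms]] 
    vec.dim_subset_UNIV[of B] by (auto simp: vec.dimension_def card_cart_basis)

lemma orthonormal_set_insert:
  assumes B: "orthonormal_set B" and "cinner x x = 1" "\<And>b. b \<in> B \<Longrightarrow> cinner b x = 0"
  shows "orthonormal_set (insert x B)"
proof -
  have "cinner x b = 0" if "b \<in> B" for b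
    using assms(3)[OF that] by (metis cnj_cinner complex_cnj_zero)
  moreover have "x \<notin> B" using assms(2,3) by force
  ultimately show ?thesis using assms unfolding orthonormal_set_def by (auto simp: of_bool_def)
qed

lemma scaleR_eq_scale: "r *\<^sub>R x = complex_of_real r *s x"
  by (simp add: vec_eq_iff scaleR_conv_of_real[where 'a=complex])

text \<open>One Gram-Schmidt step: a vector of \<open>S\<close> outside the span of
  \<open>B\<close>, minus its projection onto that span, is nonzero and orthogonal to
  \<open>B\<close>, and can be normalised.\<close>

lemma orthogonal_unit_vector:
  assumes S: "vec.subspace S" and B: "orthonormal_set B" "B \<subseteq> S" "vec.span B \<noteq> S"
  obtains x where "x \<in> S" "norm x = 1" "\<And>b. b \<in> B \<Longrightarrow> cinner b x = 0"
proof -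
  have "vec.span B \<subseteq> S" using S B by (simp add: vec.span_minimal)
  then obtain y where y: "y \<in> S" "y \<notin> vec.span B" using B by blast
  have fin: "finite B" using orthonormal_set_finite[OF B(1)] by simp
  define p where "p = (\<Sum>b\<in>B. cinner b y *s b)"
  define x where "x = y - p"
  have p: "p \<in> vec.span B"
    unfolding p_def by (intro vec.span_sum vec.span_scale vec.span_base)
  have xS: "x \<in> S" unfolding x_def
    using S y p \<open>vec.span B \<subseteq> S\<close> by (blast intro: vec.subspace_diff)
  have x0: "x \<noteq> 0" using p y(2) x_def by auto
  have orth: "cinner b x = 0" if b: "b \<in> B" for b
  proof -
    have "cinner b c = of_bool (c = b)" if "c \<in> B" for c
      using b that by (rule orthonormal_setD[OF B(1)])
    then have "cinner b p = (\<Sum>c\<in>B. cinner c y * of_bool (c = b))"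
      by (simp add: p_def cinner_sum_right cinner_scale_right)
    also have "\<dots> = cinner b y" using b fin by (simp add: sum_mult_of_bool_eq)
    finally show ?thesis by (simp add: x_def cinner_diff_right)
  qed
  have "norm (complex_of_real (1 / norm x) *s x) = 1"
    using x0 by (simp flip: scaleR_eq_scale del: of_real_divide)
  then show thesis
    using that[of "complex_of_real (1 / norm x) *s x"] xS orth S
    by (simp add: cinner_scale_right vec.subspace_scale)
qed

text \<open>Cardinalities are bounded by \<open>CARD('n)\<close>, so a largest orthonormal subset of
  \<open>S\<close> exists; if it did not span, \<open>orthogonal_unit_vector\<close> would enlarge
  it.\<close>

lemma exists_orthonormal_basis:
  fixes S :: "(complex^'n) set"
  assumes "vec.subspace S"
  obtains B where "orthonormal_set B" "B \<subseteq> S" "vec.span B = S"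
proof -
  let ?P = "\<lambda>B. orthonormal_set B \<and> B \<subseteq> S"
  have "?P {}" by (simp add: orthonormal_set_def)
  moreover have "\<forall>B. ?P B \<longrightarrow> card B < Suc CARD('n)"
    using orthonormal_set_finite(2) by (metis le_imp_less_Suc)
  ultimately have "\<exists>B. ?P B \<and> (\<forall>C. ?P C \<longrightarrow> card C \<le> card B)"
    by (rule ex_has_greatest_nat)
  then obtain B where B: "?P B" and max: "\<And>C. ?P C \<Longrightarrow> card C \<le> card B"
    by auto
  have "vec.span B = S"
  proof (rule ccontr)
    assume "vec.span B \<noteq> S"
    then obtain x where x: "x \<in> S" "norm x = 1" "\<And>b. b \<in> B \<Longrightarrow> cinner b x = 0"
      using orthogonal_unit_vector[OF assms] B by metis
    then have "orthonormal_set (insert x B)"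
      using B by (intro orthonormal_set_insert) (auto simp: cinner_self)
    moreover have "x \<notin> B" using x by (force simp: cinner_self)
    ultimately show False
      using max[of "insert x B"] B x orthonormal_set_finite(1)[of B] by simp
  qed
  with B show thesis using that by blast
qed

text \<open>Indexing by \<open>'n\<close> builds in the right cardinality, so orthonormality alone
  makes \<open>u\<close> a basis, and sums over it run over \<open>UNIV\<close>.\<close>

definition orthonormal_basis :: "('n \<Rightarrow> complex^'n) \<Rightarrow> bool" where
  "orthonormal_basis u \<longleftrightarrow> (\<forall>x y. cinner (u x) (u y) = of_bool (x = y))"

text \<open>The columns of a square matrix are orthonormal iff its rows are.\<close>

lemma orthonormal_basis_complete:
  fixes u :: "'n::finite \<Rightarrow> complex^'n"
  assumes "orthonormal_basis u"
  shows "(\<Sum>x\<in>UNIV. u x $ i * cnj (u x $ j)) = of_bool (i = j)"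
proof -
  define M :: "complex^'n^'n" where "M = (\<chi> i x. u x $ i)"
  have "dagger M ** M = mat 1"
    using assms by (simp add: M_def vec_eq_iff matrix_matrix_mult_def mat_def orthonormal_basis_def
        cinner_def of_bool_def)
  then have "M ** dagger M = mat 1" by (simp add: matrix_left_right_inverse)
  then have "(M ** dagger M) $ i $ j = mat 1 $ i $ j" by simp
  then show ?thesis by (simp add: M_def matrix_matrix_mult_def mat_def of_bool_def)
qed

lemma orthonormal_basis_expansion:
  fixes u :: "'n::finite \<Rightarrow> complex^'n"
  assumes "orthonormal_basis u"
  shows "v = (\<Sum>x\<in>UNIV. cinner (u x) v *s u x)"
proof -
  have "(\<Sum>x\<in>UNIV. cinner (u x) v *s u x) $ i = v $ i" for i
  proof -
    have "(\<Sum>x\<in>UNIV. cinner (u x) v *s u x) $ i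
        = (\<Sum>x\<in>UNIV. \<Sum>j\<in>UNIV. v $ j * (u x $ i * cnj (u x $ j)))"
      by (simp add: cinner_def sum_distrib_left mult_ac)
    also have "\<dots> = (\<Sum>j\<in>UNIV. v $ j * (\<Sum>x\<in>UNIV. u x $ i * cnj (u x $ j)))"
      by (subst sum.swap) (simp add: sum_distrib_left)
    also have "\<dots> = v $ i"
      by (simp add: orthonormal_basis_complete[OF assms] of_bool_def if_distrib cong: if_cong)
    finally show ?thesis .
  qed
  then show ?thesis by (simp add: vec_eq_iff)
qed

lemma parseval_cinner:
  assumes "orthonormal_basis u"
  shows "cinner v w = (\<Sum>x\<in>UNIV. cinner v (u x) * cinner (u x) w)"
  by (subst orthonormal_basis_expansion[OF assms, of w])
    (simp add: cinner_sum_right cinner_scale_right mult.commute)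

lemma parseval:
  assumes "orthonormal_basis u"
  shows "(\<Sum>x\<in>UNIV. (cmod (cinner (u x) v))\<^sup>2) = (norm v)\<^sup>2"
proof -
  have "complex_of_real ((norm v)\<^sup>2) = of_real (\<Sum>x\<in>UNIV. (cmod (cinner (u x) v))\<^sup>2)"
    using parseval_cinner[OF assms, of v v] cinner_mult_cnj[of "u _" v]
    by (simp add: cinner_self mult.commute[of "cinner v _"])
  then show ?thesis by (simp only: of_real_eq_iff)
qed

lemma norm_orthonormal_basis: "orthonormal_basis u \<Longrightarrow> norm (u x) = 1"
  using cinner_self[of "u x"] norm_ge_zero[of "u x"]
  by (simp add: orthonormal_basis_def power2_eq_1_iff flip: of_real_power del: norm_ge_zero)

lemma continuous_on_cinner_matrix: "continuous_on S (\<lambda>x. cinner x (A *v x))"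
  unfolding cinner_def matrix_vector_mult_def by (intro continuous_intros)

text \<open>Maximise the Rayleigh quotient over the unit sphere of \<open>S\<close>.\<close>

lemma hermitian_eigenvector_in_subspace:
  fixes A :: "complex^'n^'n"
  assumes A: "hermitian A" and S: "vec.subspace S" "\<And>x. x \<in> S \<Longrightarrow> A *v x \<in> S" "closed S"
    and ne: "z \<in> S" "norm z = 1"
  obtains x l where "x \<in> S" "norm x = 1" "A *v x = complex_of_real l *s x"
proof -
  let ?K = "S \<inter> sphere 0 1"
  have "compact ?K" using S(3) by (simp add: closed_Int_compact)
  moreover have "?K \<noteq> {}" using ne by auto
  moreover have "continuous_on ?K (\<lambda>x. Re (cinner x (A *v x)))"
    by (intro continuous_intros continuous_on_cinner_matrix)
  ultimately have "\<exists>x\<in>?K. \<forall>y\<in>?K. Re (cinner y (A *v y)) \<le> Re (cinner x (A *v x))"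
    by (rule continuous_attains_sup)
  then obtain x where x: "x \<in> ?K"
    and max: "\<And>y. y \<in> ?K \<Longrightarrow> Re (cinner y (A *v y)) \<le> Re (cinner x (A *v x))"
    by blast
  define l where "l = Re (cinner x (A *v x))"
  define w where "w = A *v x - complex_of_real l *s x"
  have nx: "norm x = 1" using x by simp
  have wS: "w \<in> S" unfolding w_def using S x by (auto intro!: vec.subspace_diff vec.subspace_scale)
  \<comment> \<open>Homogeneity carries the maximum from the unit sphere to all of
    \<open>S\<close>.\<close>
  have bound: "Re (cinner y (A *v y)) \<le> l * (norm y)\<^sup>2" if y: "y \<in> S" for y
  proof (cases "y = 0")
    case False
    let ?c = "complex_of_real (1 / norm y)"
    have "norm (?c *s y) = 1" using False by (simp flip: scaleR_eq_scale del: of_real_divide)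
    then have "?c *s y \<in> ?K" using S(1) y by (simp add: vec.subspace_scale del: of_real_divide)
    then have "Re (cinner (?c *s y) (A *v (?c *s y))) \<le> l" unfolding l_def by (rule max)
    also have "cinner (?c *s y) (A *v (?c *s y)) = of_real (1 / (norm y)\<^sup>2) * cinner y (A *v y)"
      by (simp add: vec.scale cinner_scale_left cinner_scale_right power2_eq_square)
    finally have "Re (cinner y (A *v y)) / (norm y)\<^sup>2 \<le> l"
      by (simp add: Re_divide_of_real flip: of_real_power)
    then show ?thesis using False by (simp add: field_simps)
  qed simp
  have "w = 0"
  proof (rule ccontr)
    assume "w \<noteq> 0"
    define n where "n = (norm w)\<^sup>2"
    have n: "n > 0" using \<open>w \<noteq> 0\<close> by (simp add: n_def)
    have xx: "cinner x x = 1" and nn: "cinner w w = of_real n" by (simp_all add: cinner_self nx n_def)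
    \<comment> \<open>Moving from the maximiser along the residual \<open>w\<close> raises the
      quadratic form by \<open>2 * t * n\<close> to first order; the terms with
      \<open>cinner w x\<close> and \<open>cinner x w\<close> cancel against those of the
      norm.\<close>
    have main: "2 * n \<le> t * (l * n - Re (cinner w (A *v w)))" if t: "t > 0" for t :: real
    proof -
      let ?y = "x + complex_of_real t *s w"
      have ww: "cinner w (A *v x) = cinner w w + of_real l * cinner w x"
        by (simp add: w_def cinner_diff_right cinner_diff_left cinner_scale_right)
      have xw: "cinner x (A *v w) = cinner w w + of_real l * cinner x w"
        using arg_cong[OF ww, of cnj] hermitian_cinner[OF A, of x w] by (simp add: cnj_cinner)
      have Ay: "Re (cinner ?y (A *v ?y)) = l + 2 * t * n
          + t * l * Re (cinner w x) + t * l * Re (cinner x w) + t\<^sup>2 * Re (cinner w (A *v w))"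
        using ww xw
        by (simp add: matrix_vector_right_distrib vec.scale cinner_add_left cinner_add_right
            cinner_scale_left cinner_scale_right n_def cinner_self l_def algebra_simps power2_eq_square)
      have "complex_of_real ((norm ?y)\<^sup>2) = cinner ?y ?y" by (simp add: cinner_self)
      then have "(norm ?y)\<^sup>2 = Re (cinner ?y ?y)" by (metis Re_complex_of_real)
      also have "\<dots> = 1 + t * Re (cinner w x) + t * Re (cinner x w) + t\<^sup>2 * n"
        using xx nn by (simp add: cinner_add_left cinner_add_right
            cinner_scale_left cinner_scale_right algebra_simps power2_eq_square)
      finally have ny: "(norm ?y)\<^sup>2 = \<dots>" .
      have "?y \<in> S" using x wS S(1) by (auto intro!: vec.subspace_add vec.subspace_scale)
      from bound[OF this] have "t * (2 * n) \<le> t * (t * (l * n - Re (cinner w (A *v w))))"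
        unfolding Ay ny by (simp add: algebra_simps power2_eq_square)
      then show ?thesis using t by simp
    qed
    \<comment> \<open>At \<open>t = 1\<close> the inequality gives \<open>q > 0\<close>; then
      \<open>t = n / q\<close> turns it into \<open>2 * n \<le> n\<close>.\<close>
    define q where "q = l * n - Re (cinner w (A *v w))"
    have "q > 0" using main[of 1] n by (simp add: q_def)
    then show False using main[of "n / q"] n by (simp add: q_def[symmetric])
  qed
  then show thesis using that[of x l] x nx by (simp add: w_def)
qed

text \<open>A largest orthonormal set of eigenvectors must span: otherwise its orthogonal complement
  is a nonzero closed subspace, invariant because \<open>A\<close> is hermitian, and contains a
  further eigenvector.\<close>

theorem spectral_theorem:
  fixes A :: "complex^'n^'n"
  assumes A: "hermitian A"
  obtains u l where "orthonormal_basis u" "\<And>x. A *v u x = complex_of_real (l x) *s u x"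
proof -
  let ?E = "\<lambda>x. \<exists>l::real. A *v x = complex_of_real l *s x"
  let ?P = "\<lambda>B. orthonormal_set B \<and> (\<forall>x\<in>B. ?E x)"
  have "?P {}" by (simp add: orthonormal_set_def)
  moreover have "\<forall>B. ?P B \<longrightarrow> card B < Suc CARD('n)"
    using orthonormal_set_finite(2) by (metis le_imp_less_Suc)
  ultimately have "\<exists>B. ?P B \<and> (\<forall>C. ?P C \<longrightarrow> card C \<le> card B)"
    by (rule ex_has_greatest_nat)
  then obtain B where B: "?P B" and max: "\<And>C. ?P C \<Longrightarrow> card C \<le> card B"
    by auto
  have fin: "finite B" using B orthonormal_set_finite by blast
  have span: "vec.span B = UNIV"
  proof (rule ccontr)
    assume "vec.span B \<noteq> UNIV"
    then obtain z where z: "norm z = 1" "\<And>b. b \<in> B \<Longrightarrow> cinner b z = 0"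
      using orthogonal_unit_vector[of UNIV B] B by auto
    define S where "S = {x. \<forall>b\<in>B. cinner b x = 0}"
    have "closed S"
    proof -
      have "S = (\<Inter>b\<in>B. {x. cinner b x = 0})" by (auto simp: S_def)
      moreover have "closed {x. cinner b x = 0}" for b :: "complex^'n"
        unfolding cinner_def by (intro closed_Collect_eq continuous_intros)
      ultimately show ?thesis by auto
    qed
    moreover have "vec.subspace S"
      by (auto simp: S_def vec.subspace_def cinner_add_right cinner_scale_right)
    moreover have "A *v x \<in> S" if "x \<in> S" for x
      using that B hermitian_cinner[OF A]
      by (force simp: S_def cinner_scale_left)
    ultimately obtain x l where x: "x \<in> S" "norm x = 1" "A *v x = complex_of_real l *s x"
      using hermitian_eigenvector_in_subspace[OF A, of S z] z S_def by blast
    then have "orthonormal_set (insert x B)"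
      using B by (intro orthonormal_set_insert) (auto simp: cinner_self S_def)
    moreover have "x \<notin> B" using x by (force simp: cinner_self S_def)
    ultimately show False using max[of "insert x B"] B x fin by auto
  qed
  have "card B = CARD('n)"
    using vec.dim_eq_card_independent[OF orthonormal_set_independent, of B] B span
    by (metis vec.dim_span vec.dim_UNIV card_cart_basis)
  then obtain u where u: "bij_betw u (UNIV :: 'n set) B"
    using fin finite_same_card_bij by (metis finite_code)
  have "orthonormal_basis u"
    using B u unfolding orthonormal_basis_def orthonormal_set_def bij_betw_def inj_on_def
    by (auto simp: of_bool_def)
  moreover have "\<forall>x. ?E (u x)" using u B unfolding bij_betw_def by auto
  ultimately show thesis using that by metis
qed

section \<open>Spectral calculus and relative entropy\<close>

text \<open>The sum of \<open>f x\<close> times the rank-one projection onto \<open>u x\<close>, in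
  coordinates. Functions of one hermitian operator share \<open>u\<close> and differ only in
  \<open>f\<close>.\<close>

definition spectral_op :: "('n \<Rightarrow> complex^'n) \<Rightarrow> ('n \<Rightarrow> real) \<Rightarrow> complex^'n^'n" where
  "spectral_op u f = (\<chi> i j. \<Sum>x\<in>UNIV. of_real (f x) * (u x $ i * cnj (u x $ j)))"

lemma spectral_op_vector:
  "spectral_op u f *v v = (\<Sum>x\<in>UNIV. (of_real (f x) * cinner (u x) v) *s u x)"
proof -
  have "(spectral_op u f *v v) $ i = (\<Sum>x\<in>UNIV. (of_real (f x) * cinner (u x) v) *s u x) $ i" for i
  proof -
    have "(spectral_op u f *v v) $ i
        = (\<Sum>j\<in>UNIV. \<Sum>x\<in>UNIV. of_real (f x) * (u x $ i * cnj (u x $ j)) * v $ j)"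
      by (simp add: spectral_op_def matrix_vector_mult_def sum_distrib_right)
    also have "\<dots> = (\<Sum>x\<in>UNIV. \<Sum>j\<in>UNIV. of_real (f x) * (u x $ i * cnj (u x $ j)) * v $ j)"
      by (rule sum.swap)
    also have "\<dots> = (\<Sum>x\<in>UNIV. (of_real (f x) * cinner (u x) v) *s u x) $ i"
      by (simp add: cinner_def sum_distrib_left sum_distrib_right mult_ac)
    finally show ?thesis .
  qed
  then show ?thesis by (simp add: vec_eq_iff)
qed

lemma spectral_op_basis:
  assumes "orthonormal_basis u"
  shows "spectral_op u f *v u x = of_real (f x) *s u x"
proof -
  have "spectral_op u f *v u x = (\<Sum>y\<in>UNIV. if y = x then of_real (f x) *s u x else 0)"
    unfolding spectral_op_vector
    using assms by (intro sum.cong) (auto simp: orthonormal_basis_def)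
  then show ?thesis by simp
qed

lemma matrix_eq_on_basis:
  assumes "orthonormal_basis u" "\<And>x. A *v u x = B *v u x"
  shows "A = B"
  unfolding matrix_eq
proof
  fix v
  show "A *v v = B *v v"
    by (subst (1 2) orthonormal_basis_expansion[OF assms(1), of v])
      (simp add: matrix_vector_mult_sum vec.scale assms(2))
qed

lemma spectral_op_unique:
  "orthonormal_basis u \<Longrightarrow> (\<And>x. A *v u x = of_real (f x) *s u x) \<Longrightarrow> A = spectral_op u f"
  by (rule matrix_eq_on_basis) (auto simp: spectral_op_basis)

lemma hermitian_spectral_op: "hermitian (spectral_op u f)"
  by (simp add: hermitian_def vec_eq_iff spectral_op_def mult.commute)

lemma spectral_op_mult:
  assumes "orthonormal_basis u"
  shows "spectral_op u f ** spectral_op u g = spectral_op u (\<lambda>x. f x * g x)"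
  by (rule spectral_op_unique[OF assms])
    (simp add: spectral_op_basis[OF assms] vec.scale mult.commute flip: matrix_vector_mul_assoc)

lemma spectral_op_1: "orthonormal_basis u \<Longrightarrow> spectral_op u (\<lambda>x. 1) = mat 1"
  by (rule spectral_op_unique[symmetric]) simp_all

lemma trace_mult_spectral_op:
  "trace (A ** spectral_op u f) = (\<Sum>x\<in>UNIV. of_real (f x) * cinner (u x) (A *v u x))"
proof -
  have "trace (A ** spectral_op u f)
      = (\<Sum>i\<in>UNIV. \<Sum>j\<in>UNIV. \<Sum>x\<in>UNIV. A $ i $ j * (of_real (f x) * (u x $ j * cnj (u x $ i))))"
    by (simp add: trace_def matrix_matrix_mult_def spectral_op_def sum_distrib_left)
  also have "\<dots> = (\<Sum>x\<in>UNIV. \<Sum>i\<in>UNIV. \<Sum>j\<in>UNIV. A $ i $ j * (of_real (f x) * (u x $ j * cnj (u x $ i))))"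
    by (subst (2) sum.swap, subst sum.swap) simp
  also have "\<dots> = (\<Sum>x\<in>UNIV. of_real (f x) * cinner (u x) (A *v u x))"
    by (simp add: cinner_def matrix_vector_mult_def sum_distrib_left mult_ac)
  finally show ?thesis .
qed

lemma trace_spectral_op: "orthonormal_basis u \<Longrightarrow> trace (spectral_op u f) = of_real (\<Sum>x\<in>UNIV. f x)"
  using trace_mult_spectral_op[of "mat 1" u f] by (simp add: orthonormal_basis_def)

lemma hermitian_spectral_decomposition:
  assumes "hermitian A"
  obtains u l where "orthonormal_basis u" "A = spectral_op u l"
  using spectral_theorem[OF assms] spectral_op_unique by metis

lemma cinner_spectral_op:
  assumes "orthonormal_basis u"
  shows "cinner v (spectral_op u f *v v) = of_real (\<Sum>x\<in>UNIV. f x * (cmod (cinner (u x) v))\<^sup>2)"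
proof -
  have "cinner v (spectral_op u f *v v) = (\<Sum>x\<in>UNIV. of_real (f x) * (cinner (u x) v * cinner v (u x)))"
    by (simp add: spectral_op_vector cinner_sum_right cinner_scale_right mult.assoc)
  then show ?thesis by (simp add: cinner_mult_cnj)
qed

lemma norm_spectral_op:
  assumes "orthonormal_basis u"
  shows "(norm (spectral_op u f *v v))\<^sup>2 = (\<Sum>x\<in>UNIV. (f x)\<^sup>2 * (cmod (cinner (u x) v))\<^sup>2)"
proof -
  have "cinner (u x) (spectral_op u f *v v) = of_real (f x) * cinner (u x) v" for x
    using hermitian_cinner[OF hermitian_spectral_op, of "u x" u f v]
    by (simp add: spectral_op_basis[OF assms] cinner_scale_left)
  then show ?thesis
    using parseval[OF assms, of "spectral_op u f *v v"] by (simp add: norm_mult power_mult_distrib)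
qed

section \<open>Positive operators, eigenprojections and the logarithm\<close>

lemma psd_spectral_decomposition:
  assumes "positive_semidefinite A"
  obtains u l where "orthonormal_basis u" "A = spectral_op u l" "\<And>x. l x \<ge> 0"
proof -
  obtain u l where u: "orthonormal_basis u" "A = spectral_op u l"
    using hermitian_spectral_decomposition assms positive_semidefinite_def by metis
  have "l x \<ge> 0" for x
  proof -
    have "cinner (u x) (A *v u x) = of_real (l x)"
      using u by (simp add: spectral_op_basis cinner_scale_right orthonormal_basis_def)
    then show ?thesis using assms unfolding positive_semidefinite_def by (metis Re_complex_of_real)
  qed
  with u that show thesis by blast
qed

text \<open>In an eigenbasis the quadratic form is a sum of nonnegative terms, so each vanishes; the
  same terms control the norm of \<open>A *v v\<close>.\<close>

lemma psd_kernel: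
  assumes "positive_semidefinite A" "cinner v (A *v v) = 0"
  shows "A *v v = 0"
proof -
  obtain u l where u: "orthonormal_basis u" "A = spectral_op u l" "\<And>x. l x \<ge> 0"
    using psd_spectral_decomposition[OF assms(1)] by blast
  have "(\<Sum>x\<in>UNIV. l x * (cmod (cinner (u x) v))\<^sup>2) = 0"
    using assms(2) unfolding u(2) cinner_spectral_op[OF u(1)] by (simp only: of_real_eq_0_iff)
  then have "\<forall>x. l x * (cmod (cinner (u x) v))\<^sup>2 = 0"
    using u(3) by (subst (asm) sum_nonneg_eq_0_iff) auto
  then have "(norm (A *v v))\<^sup>2 = 0"
    unfolding u(2) norm_spectral_op[OF u(1)] by (intro sum.neutral) auto
  then show ?thesis by simp
qed

text \<open>This resolves the \<open>THE\<close>. Two hermitian idempotents with equal range absorb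
  each other from the left, \<open>P ** Q = Q\<close> and \<open>Q ** P = P\<close>, and taking
  adjoints makes them equal.\<close>

lemma orthogonal_projection_unique:
  assumes P: "hermitian P" "P ** P = P" and "range (\<lambda>x. P *v x) = S"
  shows "orthogonal_projection S = P"
  unfolding orthogonal_projection_def
proof (rule the_equality)
  show "hermitian P \<and> P ** P = P \<and> range ((*v) P) = S" using assms by simp
next
  fix Q assume Q: "hermitian Q \<and> Q ** Q = Q \<and> range ((*v) Q) = S"
  have absorb: "R ** R' = R'" if R: "R ** R = R" "range ((*v) R') \<subseteq> range ((*v) R)" for R R' :: "complex^'n^'n"
    unfolding matrix_eq
  proof
    fix x
    obtain y where "R' *v x = R *v y" using R(2) by blast
    then have "R *v (R' *v x) = R' *v x" using R(1) by (metis matrix_vector_mul_assoc)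
    then show "R ** R' *v x = R' *v x" by (simp add: matrix_vector_mul_assoc)
  qed
  have "P ** Q = Q" "Q ** P = P" using Q assms by (auto intro!: absorb)
  then show "Q = P" using P Q by (metis dagger_mult hermitian_def)
qed

text \<open>Pairing the eigenvalue equation with \<open>u x\<close> shows that an eigenvector has
  components only where \<open>f x = l\<close>. The range form is what identifies the orthogonal
  projection.\<close>

lemma eigenspace_spectral_op:
  assumes u: "orthonormal_basis u"
  shows "eigenspace (spectral_op u f) l = range (\<lambda>x. spectral_op u (\<lambda>x. of_bool (f x = l)) *v x)"
    (is "?E = range (\<lambda>x. ?P *v x)")
proof (intro equalityI subsetI)
  fix v assume "v \<in> ?E"
  then have v: "spectral_op u f *v v = of_real l *s v" by (simp add: eigenspace_def)
  have "f x = l \<or> cinner (u x) v = 0" for x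
    using hermitian_cinner[OF hermitian_spectral_op, of "u x" u f v] v
    by (auto simp: spectral_op_basis[OF u] cinner_scale_left cinner_scale_right)
  then have "?P *v v = (\<Sum>x\<in>UNIV. cinner (u x) v *s u x)"
    unfolding spectral_op_vector by (intro sum.cong) auto
  then show "v \<in> range (\<lambda>x. ?P *v x)"
    using orthonormal_basis_expansion[OF u, of v] by (metis rangeI)
next
  fix v assume "v \<in> range (\<lambda>x. ?P *v x)"
  then obtain y where y: "v = ?P *v y" by blast
  have "spectral_op u f ** ?P = spectral_op u (\<lambda>x. l * of_bool (f x = l))"
    unfolding spectral_op_mult[OF u] by (rule arg_cong[of _ _ "spectral_op u"]) auto
  also have "\<dots> = cscale (of_real l) ?P"
    by (simp add: spectral_op_def vec_eq_iff sum_distrib_left mult.assoc)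
  finally have "spectral_op u f *v v = of_real l *s v"
    by (simp add: y matrix_vector_mul_assoc cscale_vector_mult)
  then show "v \<in> ?E" by (simp add: eigenspace_def)
qed

lemma mat_log2_spectral_op:
  fixes u :: "'n::finite \<Rightarrow> complex^'n"
  assumes u: "orthonormal_basis u"
  shows "mat_log2 (spectral_op u f) = spectral_op u (\<lambda>x. log 2 (f x))"
proof -
  let ?P = "\<lambda>l. spectral_op u (\<lambda>x. of_bool (f x = l))"
  have proj: "orthogonal_projection (eigenspace (spectral_op u f) l) = ?P l" for l
    by (rule orthogonal_projection_unique[OF hermitian_spectral_op])
      (simp_all add: spectral_op_mult[OF u] eigenspace_spectral_op[OF u] flip: of_bool_conj)
  have spec: "eigenspace (spectral_op u f) l \<noteq> {0} \<longleftrightarrow> l \<in> range f" for l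
  proof
    assume "l \<in> range f"
    then obtain x where x: "l = f x" by blast
    have "?P l *v u x = u x" by (simp add: spectral_op_basis[OF u] x)
    moreover have "u x \<noteq> 0" using norm_orthonormal_basis[OF u, of x] by auto
    ultimately show "eigenspace (spectral_op u f) l \<noteq> {0}"
      unfolding eigenspace_spectral_op[OF u] by (metis rangeI singletonD)
  next
    assume l: "eigenspace (spectral_op u f) l \<noteq> {0}"
    show "l \<in> range f"
    proof (rule ccontr)
      assume "l \<notin> range f"
      then have "?P l *v x = 0" for x unfolding spectral_op_vector by (intro sum.neutral) auto
      then show False using l by (simp add: eigenspace_spectral_op[OF u])
    qed
  qed
  have "mat_log2 (spectral_op u f) = (\<Sum>l\<in>range f - {0}. log 2 l *\<^sub>R ?P l)"
    unfolding mat_log2_def proj by (rule sum.cong) (auto simp: spec)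
  \<comment> \<open>\<open>log 2 0 = 0\<close> here, which agrees with the convention on the kernel,
    so the eigenvalue 0 may be put back.\<close>
  also have "\<dots> = (\<Sum>l\<in>range f. log 2 l *\<^sub>R ?P l)"
    by (rule sum.mono_neutral_left) (auto simp: log_def)
  also have "\<dots> = spectral_op u (\<lambda>x. log 2 (f x))"
  proof -
    have "(\<Sum>l\<in>range f. log 2 l *\<^sub>R ?P l) $ i $ j
        = (\<Sum>x\<in>UNIV. \<Sum>l\<in>range f. if l = f x then of_real (log 2 l) * (u x $ i * cnj (u x $ j)) else 0)" for i j
      by (subst sum.swap) (auto simp: spectral_op_def scaleR_conv_of_real[where 'a=complex]
          sum_distrib_left intro!: sum.cong)
    also have "\<dots> i j = spectral_op u (\<lambda>x. log 2 (f x)) $ i $ j" for i j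
      by (simp add: spectral_op_def)
    finally show ?thesis by (simp add: vec_eq_iff)
  qed
  finally show ?thesis .
qed

lemma range_spectral_op_subset:
  assumes v: "orthonormal_basis v" and A: "hermitian A" and ker: "\<And>b. w b = 0 \<Longrightarrow> A *v v b = 0"
  shows "range (\<lambda>x. A *v x) \<subseteq> range (\<lambda>x. spectral_op v w *v x)"
proof
  fix y assume "y \<in> range (\<lambda>x. A *v x)"
  then obtain x where y: "y = A *v x" by blast
  have c: "w b = 0 \<Longrightarrow> cinner (v b) y = 0" for b
    using ker hermitian_cinner[OF A, of "v b" x] y by simp
  \<comment> \<open>Division by zero yields 0, so \<open>\<lambda>b. 1 / w b\<close> gives the
    pseudo-inverse; it recovers \<open>y\<close> because \<open>y\<close> has no component where
    \<open>w b = 0\<close>.\<close>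
  have "spectral_op v w *v (spectral_op v (\<lambda>b. 1 / w b) *v y)
      = (\<Sum>b\<in>UNIV. (of_real (w b * (1 / w b)) * cinner (v b) y) *s v b)"
    unfolding matrix_vector_mul_assoc spectral_op_mult[OF v] by (rule spectral_op_vector)
  also have "\<dots> = (\<Sum>b\<in>UNIV. cinner (v b) y *s v b)"
    using c by (intro sum.cong) auto
  also have "\<dots> = y" using orthonormal_basis_expansion[OF v, of y] by simp
  finally show "y \<in> range (\<lambda>x. spectral_op v w *v x)" by (metis rangeI)
qed

section \<open>Relative entropy in eigenbases and its bounds\<close>

lemma matrix_diff_ldistrib: "A ** (B - C) = A ** B - A ** C"
  for A :: "'a::ring_1^'n^'m"
  by (simp add: vec_eq_iff matrix_matrix_mult_def sum_subtractf right_diff_distrib)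

text \<open>The kernel condition is the inclusion of supports, which selects the finite branch of
  the definition; each trace is then evaluated in the eigenbasis of its logarithm.\<close>

lemma relative_entropy_spectral_op:
  assumes u: "orthonormal_basis u" and v: "orthonormal_basis v"
    and ker: "\<And>b. w b = 0 \<Longrightarrow> spectral_op u s *v v b = 0"
  shows "relative_entropy (spectral_op u s) (spectral_op v w) =
    ereal ((\<Sum>a\<in>UNIV. s a * log 2 (s a))
      - (\<Sum>b\<in>UNIV. Re (cinner (v b) (spectral_op u s *v v b)) * log 2 (w b)))"
proof -
  let ?A = "spectral_op u s"
  have "trace (?A ** (mat_log2 ?A - mat_log2 (spectral_op v w)))
      = trace (?A ** mat_log2 ?A) - trace (?A ** mat_log2 (spectral_op v w))"
    by (simp add: matrix_diff_ldistrib trace_sub)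
  also have "\<dots> = of_real (\<Sum>a\<in>UNIV. s a * log 2 (s a))
      - (\<Sum>b\<in>UNIV. of_real (log 2 (w b)) * cinner (v b) (?A *v v b))"
    unfolding mat_log2_spectral_op[OF u] mat_log2_spectral_op[OF v]
    by (simp only: spectral_op_mult[OF u] trace_spectral_op[OF u] trace_mult_spectral_op)
  finally show ?thesis
    using range_spectral_op_subset[OF v hermitian_spectral_op ker]
    by (simp add: relative_entropy_def mult.commute)
qed

text \<open>The squared overlaps of two orthonormal bases sum to 1 by Parseval. Both sums thus
  become sums over pairs with common weights, and inequalities can be proved term by term.\<close>

lemma double_basis_sums:
  assumes u: "orthonormal_basis u" and v: "orthonormal_basis v"
  shows "(\<Sum>b\<in>UNIV. Re (cinner (v b) (spectral_op u s *v v b)) * g b)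
    = (\<Sum>a\<in>UNIV. \<Sum>b\<in>UNIV. s a * (cmod (cinner (u a) (v b)))\<^sup>2 * g b)"
    and "(\<Sum>a\<in>UNIV. s' a) = (\<Sum>a\<in>UNIV. \<Sum>b\<in>UNIV. s' a * (cmod (cinner (u a) (v b)))\<^sup>2)"
proof -
  show "(\<Sum>b\<in>UNIV. Re (cinner (v b) (spectral_op u s *v v b)) * g b)
    = (\<Sum>a\<in>UNIV. \<Sum>b\<in>UNIV. s a * (cmod (cinner (u a) (v b)))\<^sup>2 * g b)"
    unfolding cinner_spectral_op[OF u] Re_complex_of_real sum_distrib_right by (rule sum.swap)
  have "cmod (cinner (u a) (v b)) = cmod (cinner (v b) (u a))" for a b
    by (metis cnj_cinner complex_mod_cnj)
  then show "(\<Sum>a\<in>UNIV. s' a) = (\<Sum>a\<in>UNIV. \<Sum>b\<in>UNIV. s' a * (cmod (cinner (u a) (v b)))\<^sup>2)"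
    by (simp add: parseval[OF v] norm_orthonormal_basis[OF u] flip: sum_distrib_left)
qed

text \<open>
  The numbers \<open>s\<^sub>a |\<langle>u\<^sub>a, v\<^sub>b\<rangle>|\<^sup>2\<close> reduce both entropy bounds to \<open>ln x \<le> x - 1\<close>, applied to
  \<open>s\<^sub>a / w\<^sub>b\<close> in the first and to \<open>w\<^sub>b / s\<^sub>a\<close> in the second.
\<close>

lemma relative_entropy_le_renyi2:
  fixes u v :: "'n::finite \<Rightarrow> complex^'n"
  assumes u: "orthonormal_basis u" and v: "orthonormal_basis v"
    and s: "\<And>a. s a \<ge> 0" and w: "\<And>b. w b \<ge> 0"
    and ker: "\<And>b. w b = 0 \<Longrightarrow> spectral_op u s *v v b = 0"
  shows "(\<Sum>a\<in>UNIV. s a * ln (s a)) - (\<Sum>b\<in>UNIV. Re (cinner (v b) (spectral_op u s *v v b)) * ln (w b))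
    \<le> (\<Sum>b\<in>UNIV. (norm (spectral_op u s *v v b))\<^sup>2 / w b) - (\<Sum>a\<in>UNIV. s a)"
proof -
  let ?P = "\<lambda>a b. (cmod (cinner (u a) (v b)))\<^sup>2"
  have termwise: "s a * ln (s a) * ?P a b - s a * ?P a b * ln (w b)
      \<le> (s a)\<^sup>2 * ?P a b / w b - s a * ?P a b" for a b
  proof (cases "s a = 0 \<or> w b = 0")
    case True
    \<comment> \<open>If \<open>w b = 0\<close> the operator kills \<open>v b\<close>, so no weight
      sits where \<open>ln (w b)\<close> is a default value.\<close>
    have "s a * ?P a b = 0" if "w b = 0"
    proof -
      have "(\<Sum>a\<in>UNIV. (s a)\<^sup>2 * ?P a b) = 0"
        using norm_spectral_op[OF u, of s "v b"] ker[OF that] by simp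
      then have "(s a)\<^sup>2 * ?P a b = 0" by (subst (asm) sum_nonneg_eq_0_iff) auto
      then show ?thesis by auto
    qed
    then show ?thesis using True by auto
  next
    case False
    then have pos: "s a > 0" "w b > 0" using s[of a] w[of b] by auto
    then have "ln (s a) - ln (w b) \<le> s a / w b - 1"
      using ln_le_minus_one[of "s a / w b"] by (simp add: ln_div)
    then have "s a * ?P a b * (ln (s a) - ln (w b)) \<le> s a * ?P a b * (s a / w b - 1)"
      using pos by (intro mult_left_mono) auto
    then show ?thesis by (simp add: algebra_simps power2_eq_square)
  qed
  have "(\<Sum>a\<in>UNIV. s a * ln (s a)) - (\<Sum>b\<in>UNIV. Re (cinner (v b) (spectral_op u s *v v b)) * ln (w b))
      = (\<Sum>a\<in>UNIV. \<Sum>b\<in>UNIV. s a * ln (s a) * ?P a b - s a * ?P a b * ln (w b))"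
    unfolding double_basis_sums(1)[OF u v] double_basis_sums(2)[OF u v, of "\<lambda>a. s a * ln (s a)"]
    by (simp add: sum_subtractf)
  also have "\<dots> \<le> (\<Sum>a\<in>UNIV. \<Sum>b\<in>UNIV. (s a)\<^sup>2 * ?P a b / w b - s a * ?P a b)"
    by (intro sum_mono termwise)
  also have "\<dots> = (\<Sum>b\<in>UNIV. (norm (spectral_op u s *v v b))\<^sup>2 / w b) - (\<Sum>a\<in>UNIV. s a)"
    unfolding norm_spectral_op[OF u] double_basis_sums(2)[OF u v, of s] sum_divide_distrib
    by (subst sum.swap[of "\<lambda>b a. (s a)\<^sup>2 * ?P a b / w b"]) (simp add: sum_subtractf)
  finally show ?thesis .
qed

lemma gibbs_inequality:
  assumes u: "orthonormal_basis u" and v: "orthonormal_basis v"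
    and s: "\<And>a. s a \<ge> 0" and w: "\<And>b. w b > 0"
  shows "(\<Sum>b\<in>UNIV. Re (cinner (v b) (spectral_op u s *v v b)) * ln (w b)) - (\<Sum>a\<in>UNIV. s a * ln (s a))
    \<le> (\<Sum>b\<in>UNIV. w b) - (\<Sum>a\<in>UNIV. s a)"
proof -
  let ?P = "\<lambda>a b. (cmod (cinner (u a) (v b)))\<^sup>2"
  have termwise: "s a * ?P a b * ln (w b) - s a * ln (s a) * ?P a b \<le> w b * ?P a b - s a * ?P a b" for a b
  proof (cases "s a = 0")
    case False
    then have pos: "s a > 0" "w b > 0" using s[of a] w[of b] by auto
    then have "s a * (ln (w b) - ln (s a)) \<le> s a * (w b / s a - 1)"
      using ln_le_minus_one[of "w b / s a"] by (intro mult_left_mono) (auto simp: ln_div)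
    also have "\<dots> = w b - s a" using pos by (simp add: field_simps)
    finally have "?P a b * (s a * (ln (w b) - ln (s a))) \<le> ?P a b * (w b - s a)"
      by (intro mult_left_mono) auto
    then show ?thesis by (simp add: algebra_simps)
  qed (use w[of b] in auto)
  \<comment> \<open>Here the overlaps are summed over the other index, by Parseval in
    \<open>u\<close>.\<close>
  have W: "(\<Sum>b\<in>UNIV. w b) = (\<Sum>a\<in>UNIV. \<Sum>b\<in>UNIV. w b * ?P a b)"
    by (subst sum.swap) (simp add: parseval[OF u] norm_orthonormal_basis[OF v] flip: sum_distrib_left)
  have "(\<Sum>b\<in>UNIV. Re (cinner (v b) (spectral_op u s *v v b)) * ln (w b)) - (\<Sum>a\<in>UNIV. s a * ln (s a))
      = (\<Sum>a\<in>UNIV. \<Sum>b\<in>UNIV. s a * ?P a b * ln (w b) - s a * ln (s a) * ?P a b)"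
    unfolding double_basis_sums(1)[OF u v] double_basis_sums(2)[OF u v, of "\<lambda>a. s a * ln (s a)"]
    by (simp add: sum_subtractf)
  also have "\<dots> \<le> (\<Sum>a\<in>UNIV. \<Sum>b\<in>UNIV. w b * ?P a b - s a * ?P a b)"
    by (intro sum_mono termwise)
  also have "\<dots> = (\<Sum>b\<in>UNIV. w b) - (\<Sum>a\<in>UNIV. s a)"
    unfolding W double_basis_sums(2)[OF u v, of s] by (simp add: sum_subtractf)
  finally show ?thesis .
qed

section \<open>Tensor products of orthonormal bases\<close>

definition tensor_vec :: "complex^'r \<Rightarrow> complex^'n \<Rightarrow> complex^('r::finite \<times> 'n::finite)" where
  "tensor_vec e f = (\<chi> p. e $ fst p * f $ snd p)"

definition tensor_basis ::
  "('r \<Rightarrow> complex^'r) \<Rightarrow> ('n \<Rightarrow> complex^'n) \<Rightarrow> 'r \<times> 'n \<Rightarrow> complex^('r::finite \<times> 'n::finite)" where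
  "tensor_basis e f p = tensor_vec (e (fst p)) (f (snd p))"

lemma sum_UNIV_prod: "(\<Sum>p\<in>UNIV. g p) = (\<Sum>x\<in>UNIV. \<Sum>y\<in>UNIV. g (x, y))"
  for g :: "'a::finite \<times> 'b::finite \<Rightarrow> 'c::comm_monoid_add"
  by (simp add: sum.cartesian_product)

lemma cinner_tensor_vec: "cinner (tensor_vec e f) (tensor_vec e' f') = cinner e e' * cinner f f'"
  by (simp add: cinner_def tensor_vec_def sum_UNIV_prod sum_product mult_ac)

lemma orthonormal_tensor_basis:
  "orthonormal_basis e \<Longrightarrow> orthonormal_basis f \<Longrightarrow> orthonormal_basis (tensor_basis e f)"
  by (auto simp: orthonormal_basis_def tensor_basis_def cinner_tensor_vec prod_eq_iff)

lemma tensor_spectral_op: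
  "tensor_op (spectral_op e r) (spectral_op f a)
    = spectral_op (tensor_basis e f) (\<lambda>p. r (fst p) * a (snd p))"
  by (simp add: vec_eq_iff tensor_op_def spectral_op_def tensor_basis_def tensor_vec_def
      sum_UNIV_prod sum_product mult_ac)

text \<open>Ordering the indices with both of \<open>R\<close> before both of \<open>A\<close>
  serves the two partial traces below.\<close>

lemma cinner_tensor_matrix:
  "cinner (tensor_vec e f) (X *v tensor_vec e f) =
    (\<Sum>r\<in>UNIV. \<Sum>s\<in>UNIV. \<Sum>a\<in>UNIV. \<Sum>b\<in>UNIV.
      cnj (e $ r) * e $ s * (cnj (f $ a) * f $ b) * X $ (r, a) $ (s, b))"
proof -
  have "cinner (tensor_vec e f) (X *v tensor_vec e f) =
    (\<Sum>r\<in>UNIV. \<Sum>a\<in>UNIV. \<Sum>s\<in>UNIV. \<Sum>b\<in>UNIV.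
      cnj (e $ r) * e $ s * (cnj (f $ a) * f $ b) * X $ (r, a) $ (s, b))"
    by (simp add: cinner_def matrix_vector_mult_def tensor_vec_def sum_UNIV_prod
        sum_distrib_left mult_ac)
  then show ?thesis by (subst (2) sum.swap)
qed

text \<open>Completeness of \<open>f\<close> collapses the sum over the second factor to a partial
  trace. Together with \<open>cinner_reduced_A\<close> this makes the diagonals of the reduced
  operators the marginals of the diagonal of \<open>X\<close> in a product basis.\<close>

lemma cinner_reduced_R:
  assumes "orthonormal_basis f"
  shows "(\<Sum>y\<in>UNIV. cinner (tensor_vec e (f y)) (X *v tensor_vec e (f y)))
    = cinner e (reduced_R X *v e)"
proof -
  have "(\<Sum>y\<in>UNIV. cinner (tensor_vec e (f y)) (X *v tensor_vec e (f y))) =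
    (\<Sum>r\<in>UNIV. \<Sum>s\<in>UNIV. \<Sum>a\<in>UNIV. \<Sum>b\<in>UNIV. \<Sum>y\<in>UNIV.
      cnj (e $ r) * e $ s * (cnj (f y $ a) * f y $ b) * X $ (r, a) $ (s, b))"
    unfolding cinner_tensor_matrix
    by (subst sum.swap, rule sum.cong[OF refl])+ simp
  also have "\<dots> = (\<Sum>r\<in>UNIV. \<Sum>s\<in>UNIV. \<Sum>a\<in>UNIV. \<Sum>b\<in>UNIV.
      cnj (e $ r) * e $ s * X $ (r, a) $ (s, b) * (\<Sum>y\<in>UNIV. f y $ b * cnj (f y $ a)))"
    by (simp add: sum_distrib_left mult_ac)
  also have "\<dots> = (\<Sum>r\<in>UNIV. \<Sum>s\<in>UNIV. \<Sum>a\<in>UNIV. cnj (e $ r) * e $ s * X $ (r, a) $ (s, a))"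
    by (simp add: orthonormal_basis_complete[OF assms] sum_mult_of_bool_eq)
  also have "\<dots> = cinner e (reduced_R X *v e)"
    by (simp add: cinner_def matrix_vector_mult_def reduced_R_def sum_distrib_left
        sum_distrib_right mult_ac)
  finally show ?thesis .
qed

lemma cinner_reduced_A:
  assumes "orthonormal_basis e"
  shows "(\<Sum>x\<in>UNIV. cinner (tensor_vec (e x) f) (X *v tensor_vec (e x) f))
    = cinner f (reduced_A X *v f)"
proof -
  have "(\<Sum>x\<in>UNIV. cinner (tensor_vec (e x) f) (X *v tensor_vec (e x) f)) =
    (\<Sum>r\<in>UNIV. \<Sum>s\<in>UNIV. \<Sum>a\<in>UNIV. \<Sum>b\<in>UNIV. \<Sum>x\<in>UNIV.
      cnj (e x $ r) * e x $ s * (cnj (f $ a) * f $ b) * X $ (r, a) $ (s, b))"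
    unfolding cinner_tensor_matrix
    by (subst sum.swap, rule sum.cong[OF refl])+ simp
  also have "\<dots> = (\<Sum>r\<in>UNIV. \<Sum>s\<in>UNIV. (\<Sum>a\<in>UNIV. \<Sum>b\<in>UNIV.
      cnj (f $ a) * f $ b * X $ (r, a) $ (s, b)) * (\<Sum>x\<in>UNIV. e x $ s * cnj (e x $ r)))"
    by (simp add: sum_distrib_left sum_distrib_right mult_ac)
  also have "\<dots> = (\<Sum>r\<in>UNIV. \<Sum>a\<in>UNIV. \<Sum>b\<in>UNIV. cnj (f $ a) * f $ b * X $ (r, a) $ (r, b))"
    by (simp add: orthonormal_basis_complete[OF assms] sum_mult_of_bool_eq)
  also have "\<dots> = (\<Sum>a\<in>UNIV. \<Sum>b\<in>UNIV. \<Sum>r\<in>UNIV. cnj (f $ a) * f $ b * X $ (r, a) $ (r, b))"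
    by (subst sum.swap, rule sum.cong[OF refl])+ simp
  also have "\<dots> = cinner f (reduced_A X *v f)"
    by (simp add: cinner_def matrix_vector_mult_def reduced_A_def sum_distrib_left
        sum_distrib_right mult_ac)
  finally show ?thesis .
qed

section \<open>The projection onto a matrix algebra\<close>

text \<open>The difference of the two sides is the squared norm of \<open>l - p\<close>, where
  \<open>p\<close> is the projection of \<open>l\<close> onto the span of the \<open>h x\<close>.
  These are orthogonal but not normalised and may be zero.\<close>

lemma bessel_orthogonal:
  fixes h :: "'r::finite \<Rightarrow> complex^'n"
  assumes h: "\<And>x y. cinner (h x) (h y) = of_real (r x) * of_bool (x = y)"
  shows "(\<Sum>x\<in>UNIV. (cmod (cinner l (h x)))\<^sup>2 / r x) \<le> (norm l)\<^sup>2"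
proof -
  \<comment> \<open>When \<open>r x = 0\<close> the quotient is 0, so that index drops out of
    \<open>p\<close> and of the sum alike.\<close>
  define c where "c x = cinner (h x) l / of_real (r x)" for x
  define p where "p = (\<Sum>x\<in>UNIV. c x *s h x)"
  let ?S = "\<Sum>x\<in>UNIV. (cmod (cinner l (h x)))\<^sup>2 / r x"
  have c': "c x * cinner l (h x) = of_real ((cmod (cinner l (h x)))\<^sup>2 / r x)" for x
    using cinner_mult_cnj[of l "h x"] by (simp add: c_def mult.commute)
  have lp: "cinner l p = of_real ?S"
    by (simp add: p_def cinner_sum_right cinner_scale_right c')
  then have pl: "cinner p l = of_real ?S" by (metis cnj_cinner complex_cnj_complex_of_real)
  have "cinner p (h y) = cinner l (h y)" if "r y \<noteq> 0" for y
  proof -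
    have "cinner p (h y) = (\<Sum>x\<in>UNIV. (cnj (c x) * of_real (r x)) * of_bool (x = y))"
      by (simp add: p_def cinner_sum_left cinner_scale_left h mult.assoc)
    also have "\<dots> = cinner l (h y)"
      using that by (simp add: sum_mult_of_bool_eq c_def cnj_cinner)
    finally show ?thesis .
  qed
  then have "c y * cinner p (h y) = c y * cinner l (h y)" for y
    by (cases "r y = 0") (auto simp: c_def)
  then have pp: "cinner p p = of_real ?S"
    by (subst (2) p_def) (simp add: cinner_sum_right cinner_scale_right c')
  have "complex_of_real ((norm (l - p))\<^sup>2) = of_real ((norm l)\<^sup>2 - ?S)"
    using cinner_self[of "l - p"]
    unfolding cinner_diff_left cinner_diff_right lp pl pp cinner_self[of l] by simp
  then have "(norm (l - p))\<^sup>2 = (norm l)\<^sup>2 - ?S" by (simp only: of_real_eq_iff)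
  then show ?thesis using zero_le_power2[of "norm (l - p)"] by linarith
qed

text \<open>The logarithm splits only where both factors are positive; elsewhere the weight
  \<open>q\<close> is zero. The marginal \<open>b\<close> is kept separate from \<open>a\<close>,
  since \<open>a\<close> will be the spectrum of the reduced state in one use and of
  \<open>casimir\<close> in the other.\<close>

lemma weighted_log_product:
  fixes q :: "'a::finite \<Rightarrow> 'b::finite \<Rightarrow> real"
  assumes "\<And>x. r x \<ge> 0" "\<And>y. a y \<ge> 0"
    and "\<And>x y. r x * a y = 0 \<Longrightarrow> q x y = 0"
    and R: "\<And>x. (\<Sum>y\<in>UNIV. q x y) = r x" and A: "\<And>y. (\<Sum>x\<in>UNIV. q x y) = b y"
  shows "(\<Sum>x\<in>UNIV. \<Sum>y\<in>UNIV. q x y * ln (r x * a y))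
    = (\<Sum>x\<in>UNIV. r x * ln (r x)) + (\<Sum>y\<in>UNIV. b y * ln (a y))"
proof -
  have "q x y * ln (r x * a y) = q x y * ln (r x) + q x y * ln (a y)" for x y
  proof (cases "r x * a y = 0")
    case False
    then have "r x > 0" "a y > 0" using assms(1)[of x] assms(2)[of y] by (auto simp: less_le)
    then show ?thesis by (simp add: ln_mult distrib_left)
  qed (use assms(3) in auto)
  then have "(\<Sum>x\<in>UNIV. \<Sum>y\<in>UNIV. q x y * ln (r x * a y))
      = (\<Sum>x\<in>UNIV. (\<Sum>y\<in>UNIV. q x y) * ln (r x)) + (\<Sum>x\<in>UNIV. \<Sum>y\<in>UNIV. q x y * ln (a y))"
    by (simp add: sum.distrib sum_distrib_right)
  also have "(\<Sum>x\<in>UNIV. \<Sum>y\<in>UNIV. q x y * ln (a y)) = (\<Sum>y\<in>UNIV. (\<Sum>x\<in>UNIV. q x y) * ln (a y))"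
    by (subst sum.swap) (simp add: sum_distrib_right)
  finally show ?thesis by (simp add: R A)
qed

section \<open>Unital star-algebras of matrices with a Hilbert-Schmidt orthonormal basis\<close>

locale matrix_star_algebra =
  fixes \<A> B :: "(complex^'n^'n) set"
  assumes finite_basis: "finite B"
    and basis_subset: "B \<subseteq> \<A>"
    and basis_expansion: "\<And>Y. Y \<in> \<A> \<Longrightarrow> (\<Sum>X\<in>B. cscale (trace (dagger X ** Y)) X) = Y"
    and basis_orthonormal: "\<And>X Y. X \<in> B \<Longrightarrow> Y \<in> B \<Longrightarrow> trace (dagger X ** Y) = of_bool (X = Y)"
    and one_closed: "mat 1 \<in> \<A>"
    and mult_closed: "\<And>X Y. X \<in> \<A> \<Longrightarrow> Y \<in> \<A> \<Longrightarrow> X ** Y \<in> \<A>"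
    and dagger_closed: "\<And>X. X \<in> \<A> \<Longrightarrow> dagger X \<in> \<A>"
    and add_closed: "\<And>X Y. X \<in> \<A> \<Longrightarrow> Y \<in> \<A> \<Longrightarrow> X + Y \<in> \<A>"
    and cscale_closed: "\<And>c X. X \<in> \<A> \<Longrightarrow> cscale c X \<in> \<A>"
begin

text \<open>The Hilbert-Schmidt orthogonal projection onto \<open>\<A>\<close>.\<close>

definition proj :: "complex^'n^'n \<Rightarrow> complex^'n^'n" where
  "proj M = (\<Sum>X\<in>B. cscale (trace (dagger X ** M)) X)"

text \<open>The operator \<open>T\<close> of the opening comment.\<close>

definition casimir :: "complex^'n^'n" where
  "casimir = (\<Sum>X\<in>B. X ** dagger X)"

lemma zero_closed: "0 \<in> \<A>"
  using cscale_closed[OF one_closed, of 0] by simp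

lemma sum_closed: "(\<And>i. i \<in> I \<Longrightarrow> f i \<in> \<A>) \<Longrightarrow> (\<Sum>i\<in>I. f i) \<in> \<A>"
  by (induction I rule: infinite_finite_induct) (auto simp: zero_closed add_closed)

lemma proj_closed: "proj M \<in> \<A>"
  unfolding proj_def using basis_subset by (blast intro: sum_closed cscale_closed)

text \<open>As \<open>\<A>\<close> is closed under adjoints, \<open>dagger Y\<close> expands in
  \<open>B\<close>, hence \<open>Y\<close> in the adjoints of \<open>B\<close>; these see
  \<open>M\<close> only through the coefficients that define \<open>proj M\<close>.\<close>

lemma trace_mult_proj:
  assumes Y: "Y \<in> \<A>" shows "trace (Y ** proj M) = trace (Y ** M)"
proof -
  have "Y = dagger (\<Sum>X\<in>B. cscale (trace (dagger X ** dagger Y)) X)"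
    using basis_expansion[OF dagger_closed[OF Y]] by simp
  also have "\<dots> = (\<Sum>X\<in>B. cscale (trace (Y ** X)) (dagger X))"
    by (simp add: dagger_sum dagger_cscale flip: trace_dagger) (simp add: dagger_mult)
  finally have "trace (Y ** M) = trace ((\<Sum>X\<in>B. cscale (trace (Y ** X)) (dagger X)) ** M)" by simp
  also have "\<dots> = trace (Y ** proj M)"
    by (simp add: proj_def sum_matrix_mult matrix_mult_sum trace_sum trace_cscale
        cscale_mult_left cscale_mult_right mult.commute)
  finally show ?thesis by simp
qed

lemma trace_proj: "trace (proj M) = trace M"
  using trace_mult_proj[OF one_closed] by simp

text \<open>The same coefficients, the traces of \<open>dagger Y ** (A ** X)\<close>, expand
  \<open>A ** X\<close> over the \<open>Y\<close> and \<open>dagger Y ** A\<close> over the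
  \<open>dagger X\<close>. Exchanging the two sums therefore moves \<open>A\<close> from left to
  right.\<close>

lemma casimir_commutes:
  assumes A: "A \<in> \<A>" shows "A ** casimir = casimir ** A"
proof -
  have 1: "A ** X = (\<Sum>Y\<in>B. cscale (trace (dagger Y ** (A ** X))) Y)" if "X \<in> B" for X
    using basis_expansion[of "A ** X"] mult_closed A that basis_subset by auto
  have 2: "dagger Y ** A = (\<Sum>X\<in>B. cscale (trace (dagger Y ** (A ** X))) (dagger X))" if "Y \<in> B" for Y
  proof -
    have "dagger A ** Y = (\<Sum>X\<in>B. cscale (trace (dagger X ** (dagger A ** Y))) X)"
      using basis_expansion[of "dagger A ** Y"] mult_closed dagger_closed A that basis_subset by auto
    from arg_cong[OF this, of dagger] show ?thesis
      by (simp add: dagger_mult dagger_sum dagger_cscale flip: trace_dagger)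
        (simp add: dagger_mult matrix_mul_assoc)
  qed
  have "A ** casimir = (\<Sum>X\<in>B. (A ** X) ** dagger X)"
    by (simp add: casimir_def matrix_mult_sum matrix_mul_assoc)
  also have "\<dots> = (\<Sum>X\<in>B. \<Sum>Y\<in>B. cscale (trace (dagger Y ** (A ** X))) (Y ** dagger X))"
    by (intro sum.cong refl, subst 1) (simp_all add: sum_matrix_mult cscale_mult_left)
  also have "\<dots> = (\<Sum>Y\<in>B. \<Sum>X\<in>B. cscale (trace (dagger Y ** (A ** X))) (Y ** dagger X))"
    by (rule sum.swap)
  also have "\<dots> = (\<Sum>Y\<in>B. Y ** (dagger Y ** A))"
    by (intro sum.cong refl, subst 2) (simp_all add: matrix_mult_sum cscale_mult_right)
  also have "\<dots> = casimir ** A"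
    by (simp add: casimir_def sum_matrix_mult matrix_mul_assoc)
  finally show ?thesis .
qed

lemma trace_casimir: "trace casimir = of_nat (card B)"
proof -
  have "trace (X ** dagger X) = 1" if "X \<in> B" for X
    using basis_orthonormal[OF that that] trace_mul_sym[of X "dagger X"] by simp
  then show ?thesis by (simp add: casimir_def trace_sum)
qed

lemma cinner_casimir: "cinner v (casimir *v v) = of_real (\<Sum>X\<in>B. (norm (dagger X *v v))\<^sup>2)"
  by (simp add: casimir_def matrix_sum_vector_mult cinner_sum_right cinner_self
      flip: matrix_vector_mul_assoc) (simp add: cinner_matrix_right cinner_self)

lemma casimir_spectral_decomposition:
  obtains g t where "orthonormal_basis g" "casimir = spectral_op g t" "\<And>z. t z > 0"
proof -
  have "hermitian casimir" by (simp add: hermitian_def casimir_def dagger_sum dagger_mult)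
  then obtain g t where g: "orthonormal_basis g" "casimir = spectral_op g t"
    using hermitian_spectral_decomposition by blast
  have "t z > 0" for z
  proof -
    have "complex_of_real (t z) = cinner (g z) (casimir *v g z)"
      using g by (simp add: spectral_op_basis cinner_scale_right orthonormal_basis_def)
    then have t: "t z = (\<Sum>X\<in>B. (norm (dagger X *v g z))\<^sup>2)"
      by (simp only: cinner_casimir of_real_eq_iff)
    \<comment> \<open>A zero eigenvalue would make every \<open>dagger X\<close> kill
      \<open>g z\<close>; the identity is a combination of these, so \<open>g z\<close> would
      vanish.\<close>
    have "t z \<noteq> 0"
    proof
      assume "t z = 0"
      then have zero: "dagger X *v g z = 0" if "X \<in> B" for X
        using t finite_basis that by (simp add: sum_nonneg_eq_0_iff)
      have "mat 1 = dagger (\<Sum>X\<in>B. cscale (trace (dagger X ** mat 1)) X)"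
        using basis_expansion[OF one_closed] by simp
      then have "mat 1 *v g z = (\<Sum>X\<in>B. cnj (trace (dagger X)) *s (dagger X *v g z))"
        by (simp add: dagger_sum dagger_cscale matrix_sum_vector_mult cscale_vector_mult)
      then have "g z = 0" using zero by simp
      then show False using norm_orthonormal_basis[OF g(1), of z] by simp
    qed
    moreover have "t z \<ge> 0" unfolding t by (intro sum_nonneg) simp
    ultimately show ?thesis by simp
  qed
  with g that show thesis by blast
qed

text \<open>\<open>R\<close> inverts \<open>casimir\<close>, so it too commutes with
  \<open>\<A>\<close>. For fixed \<open>Y\<close> the sum over \<open>X\<close> is a basis expansion
  of \<open>proj M ** Y\<close>; moving \<open>R\<close> past \<open>Y\<close> then leaves the sum
  of the \<open>Y ** dagger Y\<close>, which cancels \<open>R\<close>.\<close>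

lemma trace_basis_double_sum:
  assumes R: "casimir ** R = mat 1"
  shows "(\<Sum>X\<in>B. \<Sum>Y\<in>B. trace (M ** (Y ** dagger X)) * trace ((dagger Y ** X) ** R)) = trace M"
proof -
  let ?q = "proj M"
  have R': "R ** casimir = mat 1" using R by (simp add: matrix_left_right_inverse)
  have comm: "Y ** R = R ** Y" if "Y \<in> \<A>" for Y
    using casimir_commutes[OF that] R R' by (metis matrix_mul_assoc matrix_mul_lid matrix_mul_rid)
  have inner: "(\<Sum>X\<in>B. trace (M ** (Y ** dagger X)) * trace ((dagger Y ** X) ** R))
      = trace (?q ** (R ** (Y ** dagger Y)))" if Y: "Y \<in> B" for Y
  proof -
    have qY: "?q ** Y \<in> \<A>" using Y basis_subset proj_closed mult_closed by blast
    \<comment> \<open>\<open>Y ** dagger X\<close> lies in \<open>\<A>\<close>, so \<open>M\<close>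
      may be replaced by its projection; cyclicity exposes the coefficient at
      \<open>X\<close>.\<close>
    have "trace (M ** (Y ** dagger X)) = trace (dagger X ** (?q ** Y))" if "X \<in> B" for X
    proof -
      have "trace (M ** (Y ** dagger X)) = trace ((Y ** dagger X) ** M)" by (rule trace_mul_sym)
      also have "\<dots> = trace ((Y ** dagger X) ** ?q)"
        using Y that basis_subset by (intro trace_mult_proj[symmetric] mult_closed dagger_closed) auto
      also have "\<dots> = trace (Y ** (dagger X ** ?q))" by (simp add: matrix_mul_assoc)
      also have "\<dots> = trace ((dagger X ** ?q) ** Y)" by (rule trace_mul_sym)
      finally show ?thesis by (simp add: matrix_mul_assoc)
    qed
    then have "(\<Sum>X\<in>B. trace (M ** (Y ** dagger X)) * trace ((dagger Y ** X) ** R))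
        = trace (dagger Y ** (\<Sum>X\<in>B. cscale (trace (dagger X ** (?q ** Y))) X) ** R)"
      by (simp add: matrix_mult_sum sum_matrix_mult trace_sum cscale_mult_left cscale_mult_right
          trace_cscale)
    also have "\<dots> = trace (dagger Y ** ((?q ** Y) ** R))"
      unfolding basis_expansion[OF qY] by (simp add: matrix_mul_assoc)
    also have "\<dots> = trace (((?q ** Y) ** R) ** dagger Y)" by (rule trace_mul_sym)
    also have "\<dots> = trace (?q ** ((Y ** R) ** dagger Y))" by (simp add: matrix_mul_assoc)
    also have "Y ** R = R ** Y" using comm Y basis_subset by blast
    finally show ?thesis by (simp add: matrix_mul_assoc)
  qed
  have "(\<Sum>X\<in>B. \<Sum>Y\<in>B. trace (M ** (Y ** dagger X)) * trace ((dagger Y ** X) ** R))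
      = (\<Sum>Y\<in>B. trace (?q ** (R ** (Y ** dagger Y))))"
    by (subst sum.swap) (simp add: inner)
  also have "\<dots> = trace (?q ** (R ** casimir))"
    by (simp add: casimir_def matrix_mult_sum trace_sum)
  also have "\<dots> = trace M" by (simp add: R' trace_proj)
  finally show ?thesis .
qed

section \<open>The output state on the bipartite system\<close>

lemma id_tensor_proj_nth:
  "id_tensor proj (pure_state \<psi>) $ (r, a) $ (s, b)
    = (\<Sum>X\<in>B. X $ a $ b * (\<Sum>d\<in>UNIV. \<Sum>c\<in>UNIV. cnj (X $ c $ d) * (\<psi> $ (r, c) * cnj (\<psi> $ (s, d)))))"
  by (simp add: id_tensor_def proj_def pure_state_def trace_def matrix_matrix_mult_def mult.commute)

text \<open>\<open>proj\<close> preserves the trace of every block, so the marginal on the reference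
  is still that of \<open>\<psi>\<close>, namely
  \<open>\<Psi> \<Psi>\<^sup>\<dagger>\<close>.\<close>

lemma reduced_R_id_tensor_proj:
  fixes \<psi> :: "complex^('r::finite \<times> 'n)"
  shows "reduced_R (id_tensor proj (pure_state \<psi>)) $ r $ s
    = (\<Sum>d\<in>UNIV. \<psi> $ (r, d) * cnj (\<psi> $ (s, d)))"
proof -
  let ?M = "(\<chi> c d. \<psi> $ (r, c) * cnj (\<psi> $ (s, d))) :: complex^'n^'n"
  have "reduced_R (id_tensor proj (pure_state \<psi>)) $ r $ s = trace (proj ?M)"
    by (simp add: reduced_R_def id_tensor_def pure_state_def trace_def)
  also have "\<dots> = trace ?M" by (rule trace_proj)
  finally show ?thesis by (simp add: trace_def)
qed

text \<open>The order-2 trace of the opening comment, written in the product eigenbasis; indices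
  with \<open>r x = 0\<close> contribute 0 through division by zero.\<close>

lemma renyi2_bound:
  fixes \<psi> :: "complex^('r::finite \<times> 'n)"
  assumes e: "orthonormal_basis e" "reduced_R (id_tensor proj (pure_state \<psi>)) = spectral_op e r"
    and g: "orthonormal_basis g" "casimir = spectral_op g t" "\<And>z. t z > 0"
    and tr: "trace (reduced_A (pure_state \<psi>)) = 1"
  shows "(\<Sum>x\<in>UNIV. \<Sum>z\<in>UNIV.
    (norm (id_tensor proj (pure_state \<psi>) *v tensor_vec (e x) (g z)))\<^sup>2 / (r x * t z)) \<le> 1"
proof -
  let ?\<sigma> = "id_tensor proj (pure_state \<psi>)"
  \<comment> \<open>\<open>h x\<close> is \<open>\<Psi>\<^sup>\<dagger>\<close> applied to
    \<open>e x\<close>, and \<open>K X\<close> is the entrywise conjugate of \<open>\<Psi>\<close>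
    times \<open>X\<close>. The vector \<open>l z p\<close> represents coordinate \<open>p\<close>
    of the image of \<open>tensor_vec (e x) (g z)\<close> as a functional of \<open>h x\<close>,
    with no dependence on \<open>x\<close>.\<close>
  define h :: "'r \<Rightarrow> complex^'n" where "h x = (\<chi> d. \<Sum>s\<in>UNIV. cnj (\<psi> $ (s, d)) * e x $ s)" for x
  define K :: "complex^'n^'n \<Rightarrow> complex^'n^'r"
    where "K X = (\<chi> r d. \<Sum>c\<in>UNIV. cnj (\<psi> $ (r, c)) * X $ c $ d)" for X
  define l :: "'n \<Rightarrow> 'r \<times> 'n \<Rightarrow> complex^'n"
    where "l z p = (\<chi> d. \<Sum>X\<in>B. cnj ((X *v g z) $ snd p) * K X $ fst p $ d)" for z p
  let ?R = "spectral_op g (\<lambda>z. 1 / t z)"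

  \<comment> \<open>The Gram matrix of the \<open>h x\<close> is that of
    \<open>\<Psi> \<Psi>\<^sup>\<dagger>\<close>, the reference marginal, in its own eigenbasis
    \<open>e\<close>.\<close>
  have h_orth: "cinner (h x) (h y) = of_real (r x) * of_bool (x = y)" for x y
  proof -
    have "cinner (h x) (h y) = (\<Sum>d\<in>UNIV. \<Sum>s\<in>UNIV. \<Sum>s'\<in>UNIV.
        cnj (e x $ s) * (\<psi> $ (s, d) * cnj (\<psi> $ (s', d)) * e y $ s'))"
      by (simp add: cinner_def h_def sum_product) (simp add: mult_ac)
    also have "\<dots> = (\<Sum>s\<in>UNIV. \<Sum>s'\<in>UNIV. \<Sum>d\<in>UNIV.
        cnj (e x $ s) * (\<psi> $ (s, d) * cnj (\<psi> $ (s', d)) * e y $ s'))"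
      by (subst sum.swap, rule sum.cong[OF refl], rule sum.swap)
    also have "\<dots> = cinner (e x) (reduced_R ?\<sigma> *v e y)"
      by (simp add: cinner_def matrix_vector_mult_def reduced_R_id_tensor_proj sum_distrib_left
          sum_distrib_right)
    finally show ?thesis
      using e(1) unfolding e(2) spectral_op_basis[OF e(1)]
      by (auto simp: cinner_scale_right orthonormal_basis_def)
  qed

  have apply_\<sigma>: "(?\<sigma> *v tensor_vec (e x) (g z)) $ p = cinner (l z p) (h x)" for x z p
  proof (cases p)
    case (Pair q a)
    have "(?\<sigma> *v tensor_vec (e x) (g z)) $ p
        = (\<Sum>s\<in>UNIV. \<Sum>b\<in>UNIV. (\<Sum>X\<in>B. X $ a $ b * (\<Sum>d\<in>UNIV. \<Sum>c\<in>UNIV.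
            cnj (X $ c $ d) * (\<psi> $ (q, c) * cnj (\<psi> $ (s, d))))) * (e x $ s * g z $ b))"
      by (simp add: matrix_vector_mult_def Pair sum_UNIV_prod id_tensor_proj_nth tensor_vec_def)
    also have "\<dots> = (\<Sum>s\<in>UNIV. \<Sum>b\<in>UNIV. \<Sum>X\<in>B. \<Sum>d\<in>UNIV. \<Sum>c\<in>UNIV.
        X $ a $ b * g z $ b * (\<psi> $ (q, c) * cnj (X $ c $ d)) * (cnj (\<psi> $ (s, d)) * e x $ s))"
      by (simp add: sum_distrib_left sum_distrib_right mult_ac)
    also have "\<dots> = (\<Sum>d\<in>UNIV. \<Sum>s\<in>UNIV. \<Sum>X\<in>B. \<Sum>b\<in>UNIV. \<Sum>c\<in>UNIV.
        X $ a $ b * g z $ b * (\<psi> $ (q, c) * cnj (X $ c $ d)) * (cnj (\<psi> $ (s, d)) * e x $ s))"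
    proof -
      have "(\<Sum>s\<in>UNIV. \<Sum>b\<in>UNIV. \<Sum>X\<in>B. \<Sum>d\<in>UNIV. F s b X d)
          = (\<Sum>d\<in>UNIV. \<Sum>s\<in>UNIV. \<Sum>X\<in>B. \<Sum>b\<in>UNIV. F s b X d)"
        for F :: "'r \<Rightarrow> 'n \<Rightarrow> complex^'n^'n \<Rightarrow> 'n \<Rightarrow> complex"
      proof -
        have "(\<Sum>s\<in>UNIV. \<Sum>b\<in>UNIV. \<Sum>X\<in>B. \<Sum>d\<in>UNIV. F s b X d)
            = (\<Sum>s\<in>UNIV. \<Sum>d\<in>UNIV. \<Sum>X\<in>B. \<Sum>b\<in>UNIV. F s b X d)"
        proof (rule sum.cong[OF refl])
          fix s
          have "(\<Sum>b\<in>UNIV. \<Sum>X\<in>B. \<Sum>d\<in>UNIV. F s b X d) = (\<Sum>X\<in>B. \<Sum>b\<in>UNIV. \<Sum>d\<in>UNIV. F s b X d)"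
            by (rule sum.swap)
          also have "\<dots> = (\<Sum>X\<in>B. \<Sum>d\<in>UNIV. \<Sum>b\<in>UNIV. F s b X d)"
            by (rule sum.cong[OF refl], rule sum.swap)
          also have "\<dots> = (\<Sum>d\<in>UNIV. \<Sum>X\<in>B. \<Sum>b\<in>UNIV. F s b X d)"
            by (rule sum.swap)
          finally show "(\<Sum>b\<in>UNIV. \<Sum>X\<in>B. \<Sum>d\<in>UNIV. F s b X d) = \<dots>" .
        qed
        also have "\<dots> = (\<Sum>d\<in>UNIV. \<Sum>s\<in>UNIV. \<Sum>X\<in>B. \<Sum>b\<in>UNIV. F s b X d)"
          by (rule sum.swap)
        finally show ?thesis .
      qed
      then show ?thesis .
    qed
    also have "\<dots> = (\<Sum>d\<in>UNIV. \<Sum>s\<in>UNIV. (\<Sum>X\<in>B. (X *v g z) $ a * cnj (K X $ q $ d))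
        * (cnj (\<psi> $ (s, d)) * e x $ s))"
      by (simp add: K_def matrix_vector_mult_def sum_distrib_right)
        (simp add: sum_distrib_left mult_ac)
    also have "\<dots> = cinner (l z p) (h x)"
      by (simp add: cinner_def l_def h_def Pair flip: sum_distrib_left)
    finally show ?thesis .
  qed

  have K: "(\<Sum>q\<in>UNIV. \<Sum>d\<in>UNIV. cnj (K X $ q $ d) * K Y $ q $ d)
      = trace (reduced_A (pure_state \<psi>) ** (Y ** dagger X))" for X Y
  proof -
    have "(\<Sum>q\<in>UNIV. \<Sum>d\<in>UNIV. cnj (K X $ q $ d) * K Y $ q $ d)
        = (\<Sum>q\<in>UNIV. \<Sum>d\<in>UNIV. \<Sum>c\<in>UNIV. \<Sum>c'\<in>UNIV.
            \<psi> $ (q, c) * cnj (\<psi> $ (q, c')) * (Y $ c' $ d * cnj (X $ c $ d)))"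
      by (simp add: K_def sum_product) (simp add: mult_ac)
    also have "\<dots> = (\<Sum>c\<in>UNIV. \<Sum>c'\<in>UNIV. \<Sum>q\<in>UNIV. \<Sum>d\<in>UNIV.
            \<psi> $ (q, c) * cnj (\<psi> $ (q, c')) * (Y $ c' $ d * cnj (X $ c $ d)))"
    proof -
      \<comment> \<open>Grouped into two sums over pairs, the four sums need a single
        exchange.\<close>
      have swap4: "(\<Sum>q\<in>UNIV. \<Sum>d\<in>UNIV. \<Sum>c\<in>UNIV. \<Sum>c'\<in>UNIV. F q d c c')
          = (\<Sum>c\<in>UNIV. \<Sum>c'\<in>UNIV. \<Sum>q\<in>UNIV. \<Sum>d\<in>UNIV. F q d c c')"
        for F :: "'r \<Rightarrow> 'n \<Rightarrow> 'n \<Rightarrow> 'n \<Rightarrow> complex"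
        using sum.swap[of "\<lambda>(q, d) (c, c'). F q d c c'" "UNIV \<times> UNIV" "UNIV \<times> UNIV"]
        by (simp add: sum.cartesian_product' del: UNIV_Times_UNIV)
      show ?thesis by (rule swap4)
    qed
    also have "\<dots> = trace (reduced_A (pure_state \<psi>) ** (Y ** dagger X))"
      by (simp add: trace_def matrix_matrix_mult_def reduced_A_def pure_state_def sum_product)
    finally show ?thesis .
  qed

  \<comment> \<open>With \<open>p = (q, a)\<close>, the sum over \<open>a\<close> gives the inner
    product of \<open>Y *v g z\<close> and \<open>X *v g z\<close>, and the sums over
    \<open>q\<close> and \<open>d\<close> give the trace computed in \<open>K\<close>.\<close>
  have norm_l: "(\<Sum>p\<in>UNIV. cinner (l z p) (l z p)) = (\<Sum>X\<in>B. \<Sum>Y\<in>B.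
      trace (reduced_A (pure_state \<psi>) ** (Y ** dagger X)) * cinner (g z) ((dagger Y ** X) *v g z))" for z
  proof -
    have "(\<Sum>p\<in>UNIV. cinner (l z p) (l z p))
        = (\<Sum>q\<in>UNIV. \<Sum>a\<in>UNIV. \<Sum>d\<in>UNIV. \<Sum>X\<in>B. \<Sum>Y\<in>B. (cnj ((Y *v g z) $ a) * (X *v g z) $ a)
            * (cnj (K X $ q $ d) * K Y $ q $ d))"
      by (simp add: sum_UNIV_prod cinner_def l_def sum_product) (simp add: mult_ac)
    also have "\<dots> = (\<Sum>X\<in>B. \<Sum>Y\<in>B. \<Sum>q\<in>UNIV. \<Sum>a\<in>UNIV. \<Sum>d\<in>UNIV. (cnj ((Y *v g z) $ a) * (X *v g z) $ a)
            * (cnj (K X $ q $ d) * K Y $ q $ d))"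
    proof -
      have swap5: "(\<Sum>q\<in>UNIV. \<Sum>a\<in>UNIV. \<Sum>d\<in>UNIV. \<Sum>X\<in>B. \<Sum>Y\<in>B. F q a d X Y)
          = (\<Sum>X\<in>B. \<Sum>Y\<in>B. \<Sum>q\<in>UNIV. \<Sum>a\<in>UNIV. \<Sum>d\<in>UNIV. F q a d X Y)"
        for F :: "'r \<Rightarrow> 'n \<Rightarrow> 'n \<Rightarrow> complex^'n^'n \<Rightarrow> complex^'n^'n \<Rightarrow> complex"
        using sum.swap[of "\<lambda>(q, a, d) (X, Y). F q a d X Y" "B \<times> B" "UNIV \<times> UNIV \<times> UNIV"]
        by (simp add: sum.cartesian_product' del: UNIV_Times_UNIV)
      show ?thesis by (rule swap5)
    qed
    also have "\<dots> = (\<Sum>X\<in>B. \<Sum>Y\<in>B. cinner (Y *v g z) (X *v g z)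
        * (\<Sum>q\<in>UNIV. \<Sum>d\<in>UNIV. cnj (K X $ q $ d) * K Y $ q $ d))"
    proof (intro sum.cong refl)
      fix X Y
      have "(\<Sum>q\<in>UNIV. \<Sum>a\<in>UNIV. \<Sum>d\<in>UNIV. (cnj ((Y *v g z) $ a) * (X *v g z) $ a)
            * (cnj (K X $ q $ d) * K Y $ q $ d))
          = (\<Sum>q\<in>UNIV. cinner (Y *v g z) (X *v g z) * (\<Sum>d\<in>UNIV. cnj (K X $ q $ d) * K Y $ q $ d))"
        unfolding cinner_def by (simp only: sum_product)
      then show "(\<Sum>q\<in>UNIV. \<Sum>a\<in>UNIV. \<Sum>d\<in>UNIV. (cnj ((Y *v g z) $ a) * (X *v g z) $ a)
            * (cnj (K X $ q $ d) * K Y $ q $ d))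
          = cinner (Y *v g z) (X *v g z) * (\<Sum>q\<in>UNIV. \<Sum>d\<in>UNIV. cnj (K X $ q $ d) * K Y $ q $ d)"
        by (simp only: sum_distrib_left)
    qed
    also have "\<dots> = (\<Sum>X\<in>B. \<Sum>Y\<in>B.
      trace (reduced_A (pure_state \<psi>) ** (Y ** dagger X)) * cinner (g z) ((dagger Y ** X) *v g z))"
      unfolding K cinner_matrix_left by (simp add: mult.commute matrix_vector_mul_assoc)
    finally show ?thesis .
  qed

  have R: "casimir ** ?R = mat 1"
    using g(3) by (simp add: g(2) spectral_op_mult[OF g(1)] less_imp_neq[THEN not_sym]
        flip: spectral_op_1[OF g(1)])
  \<comment> \<open>Summing over the eigenbasis \<open>g\<close> with weights \<open>1 / t z\<close>
    produces traces against the inverse of \<open>casimir\<close>, so the double sum over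
    \<open>B\<close> reduces to the trace of the input state.\<close>
  have "complex_of_real (\<Sum>z\<in>UNIV. 1 / t z * (\<Sum>p\<in>UNIV. (norm (l z p))\<^sup>2))
      = (\<Sum>z\<in>UNIV. of_real (1 / t z) * (\<Sum>p\<in>UNIV. cinner (l z p) (l z p)))"
    by (simp add: cinner_self)
  also have "\<dots> = (\<Sum>z\<in>UNIV. \<Sum>X\<in>B. \<Sum>Y\<in>B. trace (reduced_A (pure_state \<psi>) ** (Y ** dagger X))
      * (of_real (1 / t z) * cinner (g z) ((dagger Y ** X) *v g z)))"
    by (simp only: norm_l sum_distrib_left mult.left_commute)
  also have "\<dots> = (\<Sum>X\<in>B. \<Sum>Y\<in>B. \<Sum>z\<in>UNIV. trace (reduced_A (pure_state \<psi>) ** (Y ** dagger X))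
      * (of_real (1 / t z) * cinner (g z) ((dagger Y ** X) *v g z)))"
    by (subst sum.swap, rule sum.cong[OF refl], rule sum.swap)
  also have "\<dots> = (\<Sum>X\<in>B. \<Sum>Y\<in>B. trace (reduced_A (pure_state \<psi>) ** (Y ** dagger X))
      * trace ((dagger Y ** X) ** ?R))"
    by (simp only: trace_mult_spectral_op sum_distrib_left)
  also have "\<dots> = 1" using trace_basis_double_sum[OF R] tr by simp
  finally have total: "(\<Sum>z\<in>UNIV. 1 / t z * (\<Sum>p\<in>UNIV. (norm (l z p))\<^sup>2)) = 1"
    by (simp only: of_real_eq_1_iff)

  \<comment> \<open>Bessel is applied for each \<open>z\<close> and \<open>p\<close> separately, to
    the sum over \<open>x\<close>.\<close>
  have "(\<Sum>x\<in>UNIV. \<Sum>z\<in>UNIV. (norm (?\<sigma> *v tensor_vec (e x) (g z)))\<^sup>2 / (r x * t z))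
      = (\<Sum>x\<in>UNIV. \<Sum>z\<in>UNIV. \<Sum>p\<in>UNIV. 1 / t z * ((cmod (cinner (l z p) (h x)))\<^sup>2 / r x))"
    by (simp add: norm_vec_def L2_set_def sum_nonneg apply_\<sigma> sum_divide_distrib mult.commute)
  also have "\<dots> = (\<Sum>z\<in>UNIV. \<Sum>p\<in>UNIV. \<Sum>x\<in>UNIV. 1 / t z * ((cmod (cinner (l z p) (h x)))\<^sup>2 / r x))"
    by (subst sum.swap, rule sum.cong[OF refl], rule sum.swap)
  also have "\<dots> = (\<Sum>z\<in>UNIV. 1 / t z * (\<Sum>p\<in>UNIV. \<Sum>x\<in>UNIV. (cmod (cinner (l z p) (h x)))\<^sup>2 / r x))"
    by (simp only: sum_distrib_left)
  also have "\<dots> \<le> (\<Sum>z\<in>UNIV. 1 / t z * (\<Sum>p\<in>UNIV. (norm (l z p))\<^sup>2))"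
    using g(3) by (intro sum_mono mult_left_mono bessel_orthogonal h_orth) (simp add: less_imp_le)
  finally show ?thesis using total by simp
qed

text \<open>The diagonals of the state in the product bases from \<open>e\<close>, \<open>f\<close>
  and from \<open>e\<close>, \<open>g\<close> are classical joint distributions, and the argument
  runs on their marginals. Positivity is a hypothesis here; for the group average it comes from
  \<open>id_tensor_group_channel_psd\<close>.\<close>

lemma mutual_information_le:
  fixes \<psi> :: "complex^('r::finite \<times> 'n)"
  assumes psd: "positive_semidefinite (id_tensor proj (pure_state \<psi>))"
    and tr: "trace (reduced_A (pure_state \<psi>)) = 1"
  shows "mutual_information (id_tensor proj (pure_state \<psi>)) \<le> ereal (log 2 (card B))"
proof -
  define \<sigma> where "\<sigma> = id_tensor proj (pure_state \<psi>)"
  have psd: "positive_semidefinite \<sigma>" using psd \<sigma>_def by simp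
  have herm: "hermitian \<sigma>" using psd positive_semidefinite_def by blast
  then have entry: "cnj (\<sigma> $ p $ q) = \<sigma> $ q $ p" for p q
    unfolding hermitian_def by (metis dagger_nth)
  have "hermitian (reduced_R \<sigma>)" "hermitian (reduced_A \<sigma>)"
    by (simp_all add: hermitian_def vec_eq_iff reduced_R_def reduced_A_def entry)
  then obtain e r f a where e: "orthonormal_basis e" "reduced_R \<sigma> = spectral_op e r"
    and f: "orthonormal_basis f" "reduced_A \<sigma> = spectral_op f a"
    using hermitian_spectral_decomposition by metis
  obtain u s where u: "orthonormal_basis u" "\<sigma> = spectral_op u s" and s: "\<And>p. s p \<ge> 0"
    using psd_spectral_decomposition[OF psd] by blast
  obtain g t where g: "orthonormal_basis g" "casimir = spectral_op g t" "\<And>z. t z > 0"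
    using casimir_spectral_decomposition by blast

  let ?q = "\<lambda>v. Re (cinner v (\<sigma> *v v))"
  have q: "?q v \<ge> 0" for v using psd unfolding positive_semidefinite_def by blast
  have marg_R: "(\<Sum>y\<in>UNIV. ?q (tensor_vec (e x) (b y))) = r x" if "orthonormal_basis b" for b x
  proof -
    have "(\<Sum>y\<in>UNIV. cinner (tensor_vec (e x) (b y)) (\<sigma> *v tensor_vec (e x) (b y))) = of_real (r x)"
      using e cinner_reduced_R[OF that, of "e x" \<sigma>]
      by (simp add: spectral_op_basis cinner_scale_right orthonormal_basis_def)
    from arg_cong[OF this, of Re] show ?thesis by simp
  qed
  have marg_A: "(\<Sum>x\<in>UNIV. ?q (tensor_vec (e x) w)) = Re (cinner w (reduced_A \<sigma> *v w))" for w
    using cinner_reduced_A[OF e(1), of w \<sigma>] by (metis Re_sum)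
  have af: "Re (cinner (f y) (reduced_A \<sigma> *v f y)) = a y" for y
    using f by (simp add: spectral_op_basis cinner_scale_right orthonormal_basis_def)
  have r0: "r x \<ge> 0" for x unfolding marg_R[OF f(1), symmetric] by (intro sum_nonneg q)
  have a0: "a y \<ge> 0" for y unfolding af[symmetric] marg_A[symmetric] by (intro sum_nonneg q)
  have kill: "\<sigma> *v v = 0" if "?q v = 0" for v
    using psd_kernel[OF psd, of v] hermitian_quadratic_real[OF herm, of v] that by simp
  \<comment> \<open>For \<open>r x = 0\<close> the nonnegative diagonal entries along
    \<open>e x\<close> sum to 0, so each vanishes, and positivity puts those vectors in the kernel.
    \<open>kerA\<close> argues likewise on the other factor.\<close>
  have kerR: "\<sigma> *v tensor_vec (e x) (b y) = 0" if "r x = 0" "orthonormal_basis b" for x y b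
  proof (rule kill)
    have "(\<Sum>y\<in>UNIV. ?q (tensor_vec (e x) (b y))) = 0" using marg_R[OF that(2)] that(1) by simp
    then show "?q (tensor_vec (e x) (b y)) = 0"
      using q by (subst (asm) sum_nonneg_eq_0_iff) auto
  qed
  have kerA: "\<sigma> *v tensor_vec (e x) (f y) = 0" if "a y = 0" for x y
  proof (rule kill)
    have "(\<Sum>x\<in>UNIV. ?q (tensor_vec (e x) (f y))) = 0" using marg_A[of "f y"] af[of y] that by simp
    then show "?q (tensor_vec (e x) (f y)) = 0"
      using q by (subst (asm) sum_nonneg_eq_0_iff) auto
  qed

  have sum_r: "(\<Sum>x\<in>UNIV. r x) = 1"
  proof -
    have "trace (reduced_R \<sigma>) = (\<Sum>s\<in>UNIV. \<Sum>d\<in>UNIV. \<psi> $ (s, d) * cnj (\<psi> $ (s, d)))"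
      unfolding \<sigma>_def by (simp add: trace_def reduced_R_id_tensor_proj)
    also have "\<dots> = trace (reduced_A (pure_state \<psi>))"
      by (subst sum.swap) (simp add: trace_def reduced_A_def pure_state_def)
    finally show ?thesis
      using tr unfolding e(2) trace_spectral_op[OF e(1)] by (simp only: of_real_eq_1_iff)
  qed
  have sum_all: "(\<Sum>x\<in>UNIV. \<Sum>y\<in>UNIV. ?q (tensor_vec (e x) (b y))) = 1" if "orthonormal_basis b" for b
    by (simp add: marg_R[OF that] sum_r)
  have sum_a: "(\<Sum>y\<in>UNIV. a y) = 1"
    using sum_all[OF f(1)] by (subst (asm) sum.swap) (simp add: marg_A af)
  have sum_s: "(\<Sum>p\<in>UNIV. s p) = 1"
  proof -
    have "complex_of_real (\<Sum>p\<in>UNIV. s p) = trace \<sigma>" by (simp add: u(2) trace_spectral_op[OF u(1)])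
    also have "\<dots> = trace (reduced_R \<sigma>)" by (simp add: trace_def reduced_R_def sum_UNIV_prod)
    finally show ?thesis unfolding e(2) trace_spectral_op[OF e(1)] by (simp only: of_real_eq_iff sum_r)
  qed
  have sum_t: "(\<Sum>z\<in>UNIV. t z) = real (card B)"
    using trace_casimir unfolding g(2) trace_spectral_op[OF g(1)]
    by (metis of_real_eq_iff of_real_of_nat_eq)
  then have M: "real (card B) > 0" using g(3) by (metis sum_pos UNIV_not_empty finite)

  \<comment> \<open>With natural logarithms, \<open>S\<close>, \<open>H\<close> and \<open>A\<close>
    are minus the entropies of the state and of its marginals on \<open>R\<close> and
    \<open>A\<close>; \<open>A'\<close> is the trace of \<open>reduced_A \<sigma>\<close> times the
    logarithm of \<open>casimir\<close>.\<close>
  define S where "S = (\<Sum>p\<in>UNIV. s p * ln (s p))"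
  define H where "H = (\<Sum>x\<in>UNIV. r x * ln (r x))"
  define A where "A = (\<Sum>y\<in>UNIV. a y * ln (a y))"
  define A' where "A' = (\<Sum>z\<in>UNIV. Re (cinner (g z) (reduced_A \<sigma> *v g z)) * ln (t z))"

  have "mutual_information \<sigma> = relative_entropy (spectral_op u s)
      (spectral_op (tensor_basis e f) (\<lambda>p. r (fst p) * a (snd p)))"
    unfolding mutual_information_def e(2) f(2) tensor_spectral_op u(2)[symmetric] ..
  also have "\<dots> = ereal ((\<Sum>p\<in>UNIV. s p * log 2 (s p))
      - (\<Sum>p\<in>UNIV. ?q (tensor_basis e f p) * log 2 (r (fst p) * a (snd p))))"
    unfolding u(2)
  proof (rule relative_entropy_spectral_op[OF u(1) orthonormal_tensor_basis[OF e(1) f(1)]])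
    fix p assume "r (fst p) * a (snd p) = 0"
    then show "spectral_op u s *v tensor_basis e f p = 0"
      using kerR[OF _ f(1)] kerA by (auto simp: tensor_basis_def simp flip: u(2))
  qed
  also have "\<dots> = ereal ((S - (H + A)) / ln 2)"
  proof -
    have "(\<Sum>p\<in>UNIV. s p * log 2 (s p)) = S / ln 2"
      by (simp add: S_def log_def sum_divide_distrib)
    moreover have "(\<Sum>x\<in>UNIV. \<Sum>y\<in>UNIV. ?q (tensor_vec (e x) (f y)) * ln (r x * a y)) = H + A"
      unfolding H_def A_def using kerR[OF _ f(1)] kerA
      by (intro weighted_log_product r0 a0 marg_R[OF f(1)]) (auto simp: marg_A af)
    then have "(\<Sum>p\<in>UNIV. ?q (tensor_basis e f p) * log 2 (r (fst p) * a (snd p))) = (H + A) / ln 2"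
      by (simp add: sum_UNIV_prod tensor_basis_def log_def flip: sum_divide_distrib)
    ultimately show ?thesis by (simp add: diff_divide_distrib)
  qed
  finally have mi: "mutual_information \<sigma> = ereal ((S - (H + A)) / ln 2)" .

  \<comment> \<open>The comparison operator is the reference marginal tensored with the unnormalised
    \<open>casimir\<close>; the factor \<open>card B\<close> enters only in the Gibbs step.\<close>
  have "(\<Sum>p\<in>UNIV. s p * ln (s p)) - (\<Sum>p\<in>UNIV. ?q (tensor_basis e g p) * ln (r (fst p) * t (snd p)))
    \<le> (\<Sum>p\<in>UNIV. (norm (\<sigma> *v tensor_basis e g p))\<^sup>2 / (r (fst p) * t (snd p))) - (\<Sum>p\<in>UNIV. s p)"
    unfolding u(2)
  proof (rule relative_entropy_le_renyi2[OF u(1) orthonormal_tensor_basis[OF e(1) g(1)] s])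
    show "0 \<le> r (fst p) * t (snd p)" for p using r0 g(3) by (simp add: less_imp_le)
    fix p assume "r (fst p) * t (snd p) = 0"
    then have "r (fst p) = 0" using g(3) by (metis less_irrefl mult_eq_0_iff)
    then show "spectral_op u s *v tensor_basis e g p = 0"
      using kerR[OF _ g(1)] by (simp add: tensor_basis_def flip: u(2))
  qed
  moreover have "(\<Sum>p\<in>UNIV. ?q (tensor_basis e g p) * ln (r (fst p) * t (snd p))) = H + A'"
    unfolding H_def A'_def sum_UNIV_prod tensor_basis_def fst_conv snd_conv
  proof (rule weighted_log_product)
    fix x z assume "r x * t z = 0"
    then have "r x = 0" using g(3) by (metis less_irrefl mult_eq_0_iff)
    then show "?q (tensor_vec (e x) (g z)) = 0" using kerR[OF _ g(1)] by simp
  qed (use r0 g(3) marg_R[OF g(1)] marg_A in \<open>auto simp: less_imp_le\<close>)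
  moreover have "(\<Sum>p\<in>UNIV. (norm (\<sigma> *v tensor_basis e g p))\<^sup>2 / (r (fst p) * t (snd p))) \<le> 1"
    using renyi2_bound[OF e(1) e(2)[unfolded \<sigma>_def] g tr]
    by (simp add: sum_UNIV_prod tensor_basis_def \<sigma>_def)
  ultimately have ineq1: "S - (H + A') \<le> 0" by (simp add: S_def sum_s)

  have sum_A': "(\<Sum>z\<in>UNIV. Re (cinner (g z) (reduced_A \<sigma> *v g z))) = 1"
    using sum_all[OF g(1)] by (subst (asm) sum.swap) (simp add: marg_A)
  \<comment> \<open>Gibbs against the state \<open>casimir\<close> divided by \<open>card B\<close>:
    both traces are 1, and splitting the logarithm releases the term
    \<open>ln (card B)\<close>.\<close>
  have "(\<Sum>z\<in>UNIV. Re (cinner (g z) (reduced_A \<sigma> *v g z)) * ln (t z / card B)) - A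
      \<le> (\<Sum>z\<in>UNIV. t z / card B) - (\<Sum>y\<in>UNIV. a y)"
    unfolding f(2) A_def using g(3) M by (intro gibbs_inequality[OF f(1) g(1) a0]) simp
  also have "\<dots> = 0" using M by (simp add: sum_a sum_t flip: sum_divide_distrib)
  also have "(\<Sum>z\<in>UNIV. Re (cinner (g z) (reduced_A \<sigma> *v g z)) * ln (t z / card B)) = A' - ln (card B)"
    using M less_imp_neq[OF g(3), symmetric] sum_A'
    by (simp add: ln_div A'_def right_diff_distrib sum_subtractf flip: sum_distrib_right)
  finally have "S - (H + A) \<le> ln (card B)" using ineq1 by simp
  then have "(S - (H + A)) / ln 2 \<le> log 2 (card B)" by (simp add: log_def divide_right_mono)
  then show ?thesis using mi by (simp add: \<sigma>_def)
qed

end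

section \<open>The group average\<close>

definition commutant :: "(complex^'n^'n) set \<Rightarrow> (complex^'n^'n) set" where
  "commutant G = {X. \<forall>U\<in>G. U ** X = X ** U}"

lemma commutant_closed:
  shows "mat 1 \<in> commutant G" "0 \<in> commutant G"
    and "X \<in> commutant G \<Longrightarrow> Y \<in> commutant G \<Longrightarrow> X ** Y \<in> commutant G"
    and "X \<in> commutant G \<Longrightarrow> Y \<in> commutant G \<Longrightarrow> X + Y \<in> commutant G"
    and "X \<in> commutant G \<Longrightarrow> cscale c X \<in> commutant G"
proof -
  show "X ** Y \<in> commutant G" if "X \<in> commutant G" "Y \<in> commutant G"
    unfolding commutant_def
  proof (intro CollectI ballI)
    fix U assume "U \<in> G"
    then have U: "U ** X = X ** U" "U ** Y = Y ** U" using that by (auto simp: commutant_def)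
    have "U ** (X ** Y) = X ** (U ** Y)" by (simp add: matrix_mul_assoc U(1))
    then show "U ** (X ** Y) = X ** Y ** U" by (simp add: matrix_mul_assoc U(2))
  qed
qed (auto simp: commutant_def matrix_add_ldistrib matrix_add_rdistrib cscale_mult_left cscale_mult_right)

lemma commutant_dagger:
  assumes G: "\<And>U. U \<in> G \<Longrightarrow> dagger U \<in> G" and X: "X \<in> commutant G"
  shows "dagger X \<in> commutant G"
  unfolding commutant_def
proof (intro CollectI ballI)
  fix U assume "U \<in> G"
  then have "dagger U ** X = X ** dagger U" using X G unfolding commutant_def by blast
  from arg_cong[OF this, of dagger] show "U ** dagger X = dagger X ** U"
    by (simp add: dagger_mult)
qed

lemma linear_matrix_mult_left: "linear (\<lambda>X. A ** X)" for A :: "complex^'n^'n"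
  by (rule linearI) (simp_all add: vec_eq_iff matrix_matrix_mult_def sum.distrib distrib_left scaleR_sum_right)

lemma linear_matrix_mult_right: "linear (\<lambda>X. X ** A)" for A :: "complex^'n^'n"
  by (rule linearI) (simp_all add: vec_eq_iff matrix_matrix_mult_def sum.distrib distrib_right scaleR_sum_right)

lemma linear_trace: "linear (trace :: complex^'n^'n \<Rightarrow> complex)"
  by (rule linearI) (simp_all add: trace_def sum.distrib scaleR_sum_right)

locale haar_average =
  fixes G :: "(complex^'n^'n) set" and \<mu> :: "(complex^'n^'n) measure"
  assumes group: "compact_unitary_group G" and haar: "normalized_haar_measure G \<mu>"
begin

section \<open>Integration against Haar measure\<close>

lemma group_simps:
  "compact G" "mat 1 \<in> G"
  "U \<in> G \<Longrightarrow> W \<in> G \<Longrightarrow> U ** W \<in> G" "U \<in> G \<Longrightarrow> dagger U \<in> G"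
  "U \<in> G \<Longrightarrow> dagger U ** U = mat 1" "U \<in> G \<Longrightarrow> U ** dagger U = mat 1"
  using group by (auto simp: compact_unitary_group_def unitary_def)

sublocale prob_space \<mu>
  using haar by (simp add: normalized_haar_measure_def)

lemma sets_haar: "sets \<mu> = sets (restrict_space borel G)"
  using haar by (simp add: normalized_haar_measure_def)

lemma space_haar: "space \<mu> = G"
  using sets_eq_imp_space_eq[OF sets_haar] by (simp add: space_restrict_space)

lemma continuous_measurable:
  assumes "continuous_on G f" shows "f \<in> borel_measurable \<mu>"
  using borel_measurable_continuous_on_restrict[OF assms] measurable_cong_sets[OF sets_haar refl] by blast

lemma continuous_integrable:
  fixes f :: "complex^'n^'n \<Rightarrow> 'b::euclidean_space"
  assumes "continuous_on G f" shows "integrable \<mu> f"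
proof -
  have "bounded (f ` G)"
    using compact_continuous_image[OF assms group_simps(1)] by (rule compact_imp_bounded)
  then obtain C where C: "\<And>U. U \<in> G \<Longrightarrow> norm (f U) \<le> C" by (auto simp: bounded_iff)
  then show ?thesis
    by (intro integrable_const_bound[of _ C] continuous_measurable assms AE_I2 C) (simp add: space_haar)
qed

lemma continuous_conjugation: "continuous_on S (\<lambda>U. U ** M ** dagger U)" for M :: "complex^'n^'n"
proof -
  have "continuous_on S (\<lambda>U. \<chi> i j. \<Sum>l\<in>UNIV. (\<Sum>k\<in>UNIV. U $ i $ k * M $ k $ l) * cnj (U $ j $ l))"
    by (intro continuous_intros)
  then show ?thesis
    by (rule continuous_on_eq) (simp add: vec_eq_iff matrix_matrix_mult_def)
qed

text \<open>The integrand is continuous on a compact group, hence integrable, and a real-linear map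
  in finite dimension is bounded, so it passes under the integral.\<close>

lemma integral_linear_conjugation:
  fixes h :: "complex^'n^'n \<Rightarrow> 'b::euclidean_space"
  assumes "linear h"
  shows "h (group_channel \<mu> M) = (\<integral>U. h (U ** M ** dagger U) \<partial>\<mu>)"
  unfolding group_channel_def using assms
  by (intro integral_bounded_linear[symmetric] continuous_integrable continuous_conjugation)
    (simp add: linear_conv_bounded_linear)

text \<open>Conjugating the average by \<open>W\<close> replaces \<open>U\<close> by
  \<open>W ** U\<close> in the integrand, and left invariance undoes this; multiplying by
  \<open>W\<close> on the right gives commutation.\<close>

lemma group_channel_in_commutant: "group_channel \<mu> M \<in> commutant G"
  unfolding commutant_def
proof (intro CollectI ballI)
  fix W assume W: "W \<in> G"
  let ?f = "\<lambda>U. U ** M ** dagger U"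
  have dist: "distr \<mu> \<mu> (\<lambda>U. W ** U) = \<mu>"
    using haar W by (simp add: normalized_haar_measure_def)
  have "continuous_on G (\<lambda>U. W ** U)"
    by (rule linear_continuous_on) (simp add: linear_matrix_mult_left flip: linear_conv_bounded_linear)
  then have meas: "(\<lambda>U. W ** U) \<in> measurable \<mu> \<mu>"
    unfolding measurable_cong_sets[OF refl sets_haar]
    using W by (intro measurable_restrict_space2 continuous_measurable)
      (auto simp: space_haar group_simps)
  have "W ** group_channel \<mu> M ** dagger W = (\<integral>U. W ** (U ** M ** dagger U) ** dagger W \<partial>\<mu>)"
    by (rule integral_linear_conjugation[of "\<lambda>X. W ** X ** dagger W"])
      (rule linear_compose[OF linear_matrix_mult_left linear_matrix_mult_right, unfolded o_def])
  also have "\<dots> = (\<integral>U. ?f (W ** U) \<partial>\<mu>)" by (simp add: dagger_mult matrix_mul_assoc)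
  also have "\<dots> = integral\<^sup>L (distr \<mu> \<mu> (\<lambda>U. W ** U)) ?f"
    by (rule integral_distr[symmetric, OF meas continuous_measurable[OF continuous_conjugation]])
  also have "\<dots> = group_channel \<mu> M" by (simp add: dist group_channel_def)
  finally have "group_channel \<mu> M ** W = W ** group_channel \<mu> M ** dagger W ** W" by simp
  also have "\<dots> = W ** group_channel \<mu> M"
    using group_simps(5)[OF W] by (simp flip: matrix_mul_assoc)
  finally show "W ** group_channel \<mu> M = group_channel \<mu> M ** W" by simp
qed

text \<open>\<open>X\<close> commutes with \<open>U\<close>, so by cyclicity the integrand is
  constant, and the total mass is 1.\<close>

lemma trace_mult_group_channel:
  assumes X: "X \<in> commutant G" shows "trace (X ** group_channel \<mu> M) = trace (X ** M)"
proof -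
  have "trace (X ** group_channel \<mu> M) = (\<integral>U. trace (X ** (U ** M ** dagger U)) \<partial>\<mu>)"
    by (rule integral_linear_conjugation[of "\<lambda>Y. trace (X ** Y)"])
      (rule linear_compose[OF linear_matrix_mult_left linear_trace, unfolded o_def])
  also have "\<dots> = (\<integral>U. trace (X ** M) \<partial>\<mu>)"
  proof (rule Bochner_Integration.integral_cong[OF refl])
    fix U assume "U \<in> space \<mu>"
    then have U: "U \<in> G" by (simp add: space_haar)
    have "X ** (U ** M ** dagger U) = U ** (X ** M ** dagger U)"
      using X U by (simp add: commutant_def matrix_mul_assoc)
    then have "trace (X ** (U ** M ** dagger U)) = trace ((X ** M ** dagger U) ** U)"
      using trace_mul_sym by metis
    then show "trace (X ** (U ** M ** dagger U)) = trace (X ** M)"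
      using group_simps(5)[OF U] by (simp flip: matrix_mul_assoc)
  qed
  also have "\<dots> = trace (X ** M)" by (simp add: prob_space)
  finally show ?thesis .
qed

text \<open>Complete positivity on a pure input: the output is the average of the pure states of
  \<open>\<phi> U\<close>, the vector obtained by applying \<open>U\<close> to the second factor of
  \<open>\<psi>\<close>.\<close>

lemma id_tensor_group_channel_psd:
  fixes \<psi> :: "complex^('r::finite \<times> 'n)"
  shows "positive_semidefinite (id_tensor (group_channel \<mu>) (pure_state \<psi>))"
proof -
  let ?\<sigma> = "id_tensor (group_channel \<mu>) (pure_state \<psi>)"
  define \<phi> :: "complex^'n^'n \<Rightarrow> complex^('r \<times> 'n)"
    where "\<phi> U = (\<chi> p. \<Sum>c\<in>UNIV. U $ snd p $ c * \<psi> $ (fst p, c))" for U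
  have cont: "continuous_on S (\<lambda>U. pure_state (\<phi> U))" for S
    unfolding pure_state_def \<phi>_def by (simp, intro continuous_intros)
  have entry: "?\<sigma> $ p $ q = (\<integral>U. pure_state (\<phi> U) $ p $ q \<partial>\<mu>)" for p q
  proof -
    let ?M = "(\<chi> a b. \<psi> $ (fst p, a) * cnj (\<psi> $ (fst q, b))) :: complex^'n^'n"
    have "?\<sigma> $ p $ q = group_channel \<mu> ?M $ snd p $ snd q"
      by (simp add: id_tensor_def pure_state_def)
    also have "\<dots> = (\<integral>U. (U ** ?M ** dagger U) $ snd p $ snd q \<partial>\<mu>)"
      by (rule integral_linear_conjugation) (simp add: linear_iff)
    also have "\<dots> = (\<integral>U. pure_state (\<phi> U) $ p $ q \<partial>\<mu>)"
      by (simp add: pure_state_def \<phi>_def matrix_matrix_mult_def sum_distrib_left sum_distrib_right mult_ac)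
    finally show ?thesis .
  qed
  have "?\<sigma> = (\<integral>U. pure_state (\<phi> U) \<partial>\<mu>)"
  proof -
    have "(\<integral>U. pure_state (\<phi> U) \<partial>\<mu>) $ p $ q = (\<integral>U. pure_state (\<phi> U) $ p $ q \<partial>\<mu>)" for p q
      by (rule integral_bounded_linear[symmetric, OF _ continuous_integrable[OF cont]])
        (simp add: linear_iff flip: linear_conv_bounded_linear)
    then show ?thesis by (simp add: vec_eq_iff entry)
  qed
  have "hermitian ?\<sigma>"
  proof -
    have "cnj (?\<sigma> $ q $ p) = ?\<sigma> $ p $ q" for p q
    proof -
      have "cnj (\<integral>U. pure_state (\<phi> U) $ q $ p \<partial>\<mu>) = (\<integral>U. cnj (pure_state (\<phi> U) $ q $ p) \<partial>\<mu>)"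
        by simp
      then show ?thesis unfolding entry by (simp add: pure_state_def mult.commute)
    qed
    then show ?thesis by (simp add: hermitian_def vec_eq_iff)
  qed
  moreover have "0 \<le> Re (cinner x (?\<sigma> *v x))" for x
  proof -
    have "linear (\<lambda>X. Re (cinner x (X *v x)))"
    proof (rule linearI)
      fix c and X :: "complex^('r \<times> 'n)^('r \<times> 'n)"
      have "c *\<^sub>R X = cscale (of_real c) X"
        by (simp add: vec_eq_iff scaleR_conv_of_real[where 'a=complex])
      then have "(c *\<^sub>R X) *v x = of_real c *s (X *v x)"
        by (simp add: cscale_vector_mult)
      then show "Re (cinner x ((c *\<^sub>R X) *v x)) = c *\<^sub>R Re (cinner x (X *v x))"
        by (simp add: cinner_scale_right)
    qed (simp add: cinner_add_right matrix_vector_mult_add_rdistrib)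
    then have "Re (cinner x (?\<sigma> *v x)) = (\<integral>U. Re (cinner x (pure_state (\<phi> U) *v x)) \<partial>\<mu>)"
      unfolding \<open>?\<sigma> = _\<close>
      by (intro integral_bounded_linear[symmetric] continuous_integrable[OF cont])
        (simp add: linear_conv_bounded_linear)
    moreover have "cinner x (pure_state (\<phi> U) *v x) = cinner x (\<phi> U) * cinner (\<phi> U) x" for U
      by (simp add: cinner_def pure_state_def matrix_vector_mult_def sum_product sum_distrib_left mult_ac)
    ultimately show ?thesis by (simp add: cinner_mult_cnj)
  qed
  ultimately show ?thesis by (simp add: positive_semidefinite_def)
qed

end

section \<open>The dual of the conditional expectation\<close>

lemma trace_pairing_nondegenerate:
  fixes X Y :: "complex^'n^'n"
  assumes "\<And>a. trace (X ** a) = trace (Y ** a)" shows "X = Y"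
proof -
  \<comment> \<open>Pairing with a matrix unit reads off a single entry.\<close>
  have "X $ i $ j = trace (X ** (\<chi> k l. if k = j then if l = i then 1 else 0 else 0))" for X :: "complex^'n^'n" and i j
    by (simp add: trace_def matrix_matrix_mult_def if_distrib[of "(*) _"] cong: if_cong)
  then show ?thesis using assms by (simp add: vec_eq_iff)
qed

lemma hs_dual_eqI:
  assumes "\<And>\<rho> a. trace (S \<rho> ** a) = trace (\<rho> ** T a)" shows "hs_dual T = S"
  unfolding hs_dual_def
proof (rule the_equality)
  fix S' assume S': "\<forall>\<rho> a. trace (S' \<rho> ** a) = trace (\<rho> ** T a)"
  show "S' = S"
  proof
    fix \<rho>
    show "S' \<rho> = S \<rho>" by (rule trace_pairing_nondegenerate) (simp add: assms S')
  qed
qed (use assms in blast)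

lemma ergodic_projection_idempotent:
  fixes T :: "complex^'n^'n \<Rightarrow> complex^'n^'n"
  assumes "\<And>X. T (T X) = T X" shows "ergodic_projection T = T"
proof
  fix X
  have pow: "(T ^^ Suc t) X = T X" for t by (induction t) (simp_all add: assms)
  \<comment> \<open>The first summand \<open>T ^^ 0\<close> is the identity, so among
    \<open>Suc N\<close> terms \<open>X\<close> occurs once and \<open>T X\<close> occurs
    \<open>N\<close> times. Working at \<open>Suc N\<close> keeps the denominator nonzero.\<close>
  have "(1 / real (Suc N)) *\<^sub>R (\<Sum>t<Suc N. (T ^^ t) X) = T X + (1 / real (Suc N)) *\<^sub>R (X - T X)" for N
  proof -
    have "(\<Sum>t<Suc N. (T ^^ t) X) = X + real N *\<^sub>R T X"
      using pow by (subst sum.lessThan_Suc_shift) (simp del: funpow.simps sum_constant add: sum_constant_scaleR)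
    also have "\<dots> = real (Suc N) *\<^sub>R T X + (X - T X)" by (simp add: algebra_simps)
    finally show ?thesis by (simp add: scaleR_add_right)
  qed
  moreover have "(\<lambda>N. T X + (1 / real (Suc N)) *\<^sub>R (X - T X)) \<longlonglongrightarrow> T X + 0 *\<^sub>R (X - T X)"
    by (intro tendsto_intros LIMSEQ_Suc lim_1_over_n)
  ultimately have "(\<lambda>N. (1 / real (Suc N)) *\<^sub>R (\<Sum>t<Suc N. (T ^^ t) X)) \<longlonglongrightarrow> T X" by simp
  then show "ergodic_projection T X = T X"
    unfolding ergodic_projection_def by (rule limI[OF LIMSEQ_imp_Suc])
qed

section \<open>Dimension of the commutant\<close>

lemma orthonormal_set_expansion:
  assumes B: "orthonormal_set B" and x: "x \<in> vec.span B"
  shows "(\<Sum>b\<in>B. cinner b x *s b) = x"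
proof -
  have fin: "finite B" using orthonormal_set_finite[OF B] by simp
  have "vec.subspace {x. (\<Sum>b\<in>B. cinner b x *s b) = x}"
  proof -
    have "(\<Sum>b\<in>B. cinner b (c *s x) *s b) = c *s (\<Sum>b\<in>B. cinner b x *s b)" for c x
      by (simp add: cinner_scale_right vec.scale_sum_right)
    moreover have "(\<Sum>b\<in>B. cinner b (x + y) *s b)
        = (\<Sum>b\<in>B. cinner b x *s b) + (\<Sum>b\<in>B. cinner b y *s b)" for x y
      by (simp add: cinner_add_right vec.scale_left_distrib sum.distrib)
    ultimately show ?thesis by (simp add: vec.subspace_def)
  qed
  moreover have "B \<subseteq> {x. (\<Sum>b\<in>B. cinner b x *s b) = x}"
  proof (intro subsetI CollectI)
    fix c assume c: "c \<in> B"
    have "(\<Sum>b\<in>B. cinner b c *s b) = (\<Sum>b\<in>B. if b = c then b else 0)"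
      using orthonormal_setD[OF B _ c] by (intro sum.cong) auto
    then show "(\<Sum>b\<in>B. cinner b c *s b) = c" using fin c by simp
  qed
  ultimately show ?thesis using x vec.span_minimal by blast
qed

text \<open>A relational form of orthogonal projection; idempotence follows from fixing
  \<open>W\<close> pointwise.\<close>

definition projects_onto :: "complex^'n^'n \<Rightarrow> (complex^'n) set \<Rightarrow> bool" where
  "projects_onto P W \<longleftrightarrow> dagger P = P \<and> (\<forall>x. P *v x \<in> W) \<and> (\<forall>x\<in>W. P *v x = x)"

lemma exists_projection:
  assumes "vec.subspace W" obtains P where "projects_onto P W"
proof -
  obtain B where B: "orthonormal_set B" "vec.span B = W"
    using exists_orthonormal_basis[OF assms] by metis
  define P where "P = (\<chi> i j. \<Sum>b\<in>B. b $ i * cnj (b $ j))"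
  have P: "P *v x = (\<Sum>b\<in>B. cinner b x *s b)" for x
  proof -
    have "(P *v x) $ i = (\<Sum>b\<in>B. \<Sum>j\<in>UNIV. b $ i * cnj (b $ j) * x $ j)" for i
      by (subst sum.swap) (simp add: P_def matrix_vector_mult_def sum_distrib_right)
    then show ?thesis by (simp add: vec_eq_iff cinner_def sum_distrib_left sum_distrib_right mult_ac)
  qed
  have "P *v x \<in> W" for x
    unfolding P B(2)[symmetric] by (intro vec.span_sum vec.span_scale vec.span_base)
  moreover have "P *v x = x" if "x \<in> W" for x
    using orthonormal_set_expansion[OF B(1)] that by (simp add: P B(2))
  moreover have "dagger P = P" by (simp add: P_def vec_eq_iff mult.commute)
  ultimately show thesis using that unfolding projects_onto_def by blast
qed

text \<open>It lets the codomain of an operator be stated as a matrix equation, the form in which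
  corners \<open>P ** Z ** P'\<close> are handled below.\<close>

lemma projects_onto_mult_left: "projects_onto P W \<Longrightarrow> P ** X = X \<longleftrightarrow> (\<forall>x. X *v x \<in> W)"
  unfolding projects_onto_def matrix_eq by (metis matrix_vector_mul_assoc)

lemma projects_onto_idem: "projects_onto P W \<Longrightarrow> P ** P = P"
  using projects_onto_mult_left projects_onto_def by blast

lemma projects_onto_closed:
  assumes "projects_onto P W" shows "closed W"
proof -
  have "W = {x. P *v x = x}" using assms unfolding projects_onto_def by (metis (mono_tags) Collect_cong Collect_mem_eq)
  moreover have "closed {x. P *v x = x}"
    unfolding vec_eq_iff matrix_vector_mult_def by (simp, intro closed_Collect_all closed_Collect_eq continuous_intros)
  ultimately show ?thesis by simp
qed

text \<open>These are the two invariant subspaces behind Schur's lemma: eigenspaces, which are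
  kernels for \<open>c = 0\<close>, and images.\<close>

lemma subspace_intertwiner:
  assumes W: "invariant_subspace G W" and Z: "Z \<in> commutant G"
  shows "invariant_subspace G {y \<in> W. Z *v y = c *s y}" "invariant_subspace G ((\<lambda>y. Z *v y) ` W)"
proof -
  have comm: "Z *v (U *v x) = U *v (Z *v x)" if "U \<in> G" for U x
    using Z that unfolding commutant_def by (simp add: matrix_vector_mul_assoc)
  have sub: "vec.subspace W" and inv: "\<And>U x. U \<in> G \<Longrightarrow> x \<in> W \<Longrightarrow> U *v x \<in> W"
    using W by (auto simp: invariant_subspace_def)
  have "vec.subspace {y \<in> W. Z *v y = c *s y}"
    using sub unfolding vec.subspace_def
    by (auto simp: matrix_vector_right_distrib vec.scale vec.scale_right_distrib vec.scale_left_commute)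
  then show "invariant_subspace G {y \<in> W. Z *v y = c *s y}"
    using inv comm by (auto simp: invariant_subspace_def vec.scale)
  show "invariant_subspace G ((\<lambda>y. Z *v y) ` W)"
    unfolding invariant_subspace_def
  proof (intro conjI ballI)
    show "vec.subspace ((\<lambda>y. Z *v y) ` W)" by (rule vec.subspace_image[OF sub])
    show "U *v x \<in> (\<lambda>y. Z *v y) ` W" if U: "U \<in> G" and x: "x \<in> (\<lambda>y. Z *v y) ` W" for U x
    proof -
      obtain y where "y \<in> W" "x = Z *v y" using x by blast
      then have "U *v x = Z *v (U *v y)" "U *v y \<in> W" using U inv comm by auto
      then show ?thesis by blast
    qed
  qed
qed

section \<open>Schur's lemma for a set of matrices closed under adjoints\<close>

locale dagger_closed_set =
  fixes G :: "(complex^'n^'n) set"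
  assumes dagger_in: "\<And>U. U \<in> G \<Longrightarrow> dagger U \<in> G"
begin

text \<open>Invariance gives \<open>P ** V ** P = V ** P\<close> for \<open>V\<close> equal to
  \<open>U\<close> and to \<open>dagger U\<close>; the adjoint of the second identity is
  \<open>P ** U ** P = P ** U\<close>.\<close>

lemma projection_in_commutant:
  assumes W: "invariant_subspace G W" and P: "projects_onto P W"
  shows "P \<in> commutant G"
  unfolding commutant_def
proof (intro CollectI ballI)
  fix U assume U: "U \<in> G"
  have *: "P ** (V ** P) = V ** P" if "V \<in> G" for V
  proof -
    have "(V ** P) *v x \<in> W" for x
      using P W that by (simp add: projects_onto_def invariant_subspace_def flip: matrix_vector_mul_assoc)
    then show ?thesis using projects_onto_mult_left[OF P] by blast
  qed
  have "P ** U = dagger (dagger U ** P)" using P by (simp add: dagger_mult projects_onto_def)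
  also have "\<dots> = dagger (P ** (dagger U ** P))" using *[OF dagger_in[OF U]] by simp
  also have "\<dots> = P ** (U ** P)" using P by (simp add: dagger_mult projects_onto_def matrix_mul_assoc)
  finally show "U ** P = P ** U" using *[OF U] by simp
qed

text \<open>A hermitian \<open>Z\<close> has an eigenvector in \<open>W\<close>; the eigenspace
  inside \<open>W\<close> is invariant and nonzero, hence all of \<open>W\<close>.\<close>

lemma schur_scalar_hermitian:
  assumes W: "irreducible_subspace G W" and P: "projects_onto P W"
    and Z: "Z \<in> commutant G" "P ** Z = Z" "Z ** P = Z" "hermitian Z"
  shows "\<exists>c. Z = cscale c P"
proof -
  have inv: "invariant_subspace G W" and sub: "vec.subspace W" and ne: "W \<noteq> {0}"
    using W by (auto simp: irreducible_subspace_def invariant_subspace_def)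
  have ZW: "Z *v x \<in> W" for x using Z(2) projects_onto_mult_left[OF P] by blast
  have "vec.span {} \<noteq> W" using ne by simp
  then obtain z where z: "z \<in> W" "norm z = 1"
    using orthogonal_unit_vector[OF sub, of "{}"] by (auto simp: orthonormal_set_def)
  obtain x l where x: "x \<in> W" "norm x = 1" "Z *v x = complex_of_real l *s x"
    using hermitian_eigenvector_in_subspace[OF Z(4) sub ZW projects_onto_closed[OF P] z] .
  let ?E = "{y \<in> W. Z *v y = complex_of_real l *s y}"
  have "x \<in> ?E" "x \<noteq> 0" using x by auto
  then have "?E \<noteq> {0}" by blast
  then have "?E = W"
    using W subspace_intertwiner(1)[OF inv Z(1)] by (auto simp: irreducible_subspace_def)
  then have "Z *v (P *v v) = complex_of_real l *s (P *v v)" for v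
    using P by (auto simp: projects_onto_def)
  then have "Z ** P = cscale l P"
    unfolding matrix_eq by (simp add: cscale_vector_mult flip: matrix_vector_mul_assoc)
  then show ?thesis using Z(3) by metis
qed

lemma schur_scalar:
  assumes W: "irreducible_subspace G W" and P: "projects_onto P W"
    and Z: "Z \<in> commutant G" "P ** Z = Z" "Z ** P = Z"
  shows "\<exists>c. Z = cscale c P"
proof -
  have Z': "dagger Z \<in> commutant G" "P ** dagger Z = dagger Z" "dagger Z ** P = dagger Z"
    using commutant_dagger[OF dagger_in Z(1)] arg_cong[OF Z(2), of dagger] arg_cong[OF Z(3), of dagger] P
    by (auto simp: dagger_mult projects_onto_def)
  \<comment> \<open>\<open>Z\<close> is split into its hermitian and skew parts, with a factor
    \<open>\<i>\<close> making the latter hermitian.\<close>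
  have comb: "\<exists>c. cscale a Z + cscale b (dagger Z) = cscale c P"
    if "hermitian (cscale a Z + cscale b (dagger Z))" for a b
    using that Z Z'
    by (intro schur_scalar_hermitian[OF W P])
      (auto intro!: commutant_closed simp: matrix_add_ldistrib matrix_add_rdistrib
        cscale_mult_left cscale_mult_right)
  obtain c where c: "cscale (1/2) Z + cscale (1/2) (dagger Z) = cscale c P"
    using comb[of "1/2" "1/2"] by (auto simp: hermitian_def dagger_add dagger_cscale add.commute)
  obtain c' where c': "cscale (\<i>/2) Z + cscale (-\<i>/2) (dagger Z) = cscale c' P"
    using comb[of "\<i>/2" "-\<i>/2"] by (auto simp: hermitian_def dagger_add dagger_cscale add.commute)
  have "Z = (cscale (1/2) Z + cscale (1/2) (dagger Z))
      + cscale (-\<i>) (cscale (\<i>/2) Z + cscale (-\<i>/2) (dagger Z))"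
    by (simp add: vec_eq_iff algebra_simps)
  also have "\<dots> = cscale (c - \<i> * c') P"
    unfolding c c' by (simp add: vec_eq_iff algebra_simps)
  finally show ?thesis by blast
qed

text \<open>The kernel of \<open>Z\<close> in \<open>W'\<close> and the image of \<open>W'\<close>
  in \<open>W\<close> are invariant; as \<open>Z\<close> is nonzero, irreducibility makes
  \<open>Z\<close> a bijection from \<open>W'\<close> to \<open>W\<close>.\<close>

lemma schur_equivalent:
  assumes W: "irreducible_subspace G W" "projects_onto P W"
    and W': "irreducible_subspace G W'" "projects_onto P' W'"
    and Z: "Z \<in> commutant G" "P ** Z = Z" "Z ** P' = Z" "Z \<noteq> 0"
  shows "equivalent_reps G W' W"
proof -
  have inv: "invariant_subspace G W" "invariant_subspace G W'" "vec.subspace W'"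
    using W W' by (auto simp: irreducible_subspace_def invariant_subspace_def)
  obtain v where "Z *v v \<noteq> 0" using Z(4) by (metis matrix_eq matrix_vector_mult_0)
  then have v: "Z *v (P' *v v) \<noteq> 0" "P' *v v \<in> W'"
    using Z(3) W'(2) by (auto simp: matrix_vector_mul_assoc projects_onto_def)
  have "{y \<in> W'. Z *v y = 0} = {0}"
    using W'(1) subspace_intertwiner(1)[OF inv(2) Z(1), of 0] v by (auto simp: irreducible_subspace_def)
  then have "inj_on (\<lambda>y. Z *v y) W'"
    using inv(3) vec.subspace_diff[OF inv(3)]
    by (intro inj_onI) (metis (mono_tags, lifting) eq_iff_diff_eq_0 matrix_vector_mult_diff_distrib mem_Collect_eq singletonD)
  moreover have "(\<lambda>y. Z *v y) ` W' = W"
  proof -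
    have "(\<lambda>y. Z *v y) ` W' \<subseteq> W" using Z(2) projects_onto_mult_left[OF W(2)] by blast
    moreover have "(\<lambda>y. Z *v y) ` W' \<noteq> {0}" using v by blast
    ultimately show ?thesis
      using W(1) subspace_intertwiner(2)[OF inv(2) Z(1)] unfolding irreducible_subspace_def by blast
  qed
  moreover have "\<forall>U\<in>G. \<forall>x\<in>W'. Z *v (U *v x) = U *v (Z *v x)"
    using Z(1) by (simp add: commutant_def matrix_vector_mul_assoc)
  ultimately show ?thesis unfolding equivalent_reps_def bij_betw_def by blast
qed

text \<open>Any nonzero intertwiner \<open>Z\<close> serves as generator:
  \<open>Z ** dagger Z = cscale \<nu> P\<close> with \<open>\<nu>\<close> nonzero, and
  \<open>dagger Z ** Y\<close> is a multiple \<open>l\<close> of \<open>P'\<close>, so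
  \<open>\<nu>\<close> times \<open>Y\<close> equals \<open>l\<close> times \<open>Z\<close>.
  Without such a \<open>Z\<close> every \<open>Y\<close> is 0.\<close>

lemma schur_one_dimensional:
  assumes W: "irreducible_subspace G W" "projects_onto P W"
    and W': "irreducible_subspace G W'" "projects_onto P' W'"
  shows "\<exists>C. \<forall>Y. Y \<in> commutant G \<and> P ** Y = Y \<and> Y ** P' = Y \<longrightarrow> (\<exists>c. Y = cscale c C)"
proof (cases "\<exists>Z. Z \<in> commutant G \<and> P ** Z = Z \<and> Z ** P' = Z \<and> Z \<noteq> 0")
  case True
  then obtain Z where Z: "Z \<in> commutant G" "P ** Z = Z" "Z ** P' = Z" "Z \<noteq> 0" by blast
  have Z': "dagger Z \<in> commutant G" "P' ** dagger Z = dagger Z" "dagger Z ** P = dagger Z"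
    using commutant_dagger[OF dagger_in Z(1)] arg_cong[OF Z(2), of dagger] arg_cong[OF Z(3), of dagger]
      W(2) W'(2) by (auto simp: dagger_mult projects_onto_def)
  have "\<exists>\<nu>. Z ** dagger Z = cscale \<nu> P"
    using Z Z' by (intro schur_scalar[OF W] commutant_closed) (simp_all add: matrix_mul_assoc, simp flip: matrix_mul_assoc)
  then obtain \<nu> where \<nu>: "Z ** dagger Z = cscale \<nu> P" by blast
  have "\<nu> \<noteq> 0"
  proof
    assume "\<nu> = 0"
    then have "Z ** dagger Z = 0" using \<nu> by simp
    then have "cinner (dagger Z *v x) (dagger Z *v x) = 0" for x
      by (simp add: cinner_matrix_left matrix_vector_mul_assoc)
    then have "dagger Z = 0" by (simp add: matrix_eq)
    then show False using Z(4) by (metis dagger_dagger dagger_zero)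
  qed
  have "\<exists>c. Y = cscale c Z" if Y: "Y \<in> commutant G" "P ** Y = Y" "Y ** P' = Y" for Y
  proof -
    have "\<exists>l. dagger Z ** Y = cscale l P'"
      using Y Z' by (intro schur_scalar[OF W'] commutant_closed) (simp_all add: matrix_mul_assoc, simp flip: matrix_mul_assoc)
    then obtain l where l: "dagger Z ** Y = cscale l P'" by blast
    have "cscale \<nu> Y = cscale \<nu> P ** Y" by (simp add: cscale_mult_left Y(2))
    also have "\<dots> = Z ** cscale l P'" by (simp add: matrix_mul_assoc flip: \<nu> l)
    also have "\<dots> = cscale l Z" by (simp add: cscale_mult_right Z(3))
    finally have "cscale (1 / \<nu>) (cscale \<nu> Y) = cscale (1 / \<nu>) (cscale l Z)" by simp
    then show ?thesis using \<open>\<nu> \<noteq> 0\<close> by (auto simp: cscale_cscale)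
  qed
  then show ?thesis by blast
qed (metis cscale_zero(1))

end

text \<open>Turns matrices into vectors so that span, dimension and orthonormal bases apply; by
  \<open>cinner_flatten\<close> the inner product becomes the Hilbert-Schmidt one.\<close>

definition flatten :: "complex^'n^'n \<Rightarrow> complex^('n \<times> 'n)" where
  "flatten X = (\<chi> p. X $ fst p $ snd p)"

definition unflatten :: "complex^('n \<times> 'n) \<Rightarrow> complex^'n^'n" where
  "unflatten x = (\<chi> i j. x $ (i, j))"

lemma flatten_unflatten [simp]: "flatten (unflatten x) = x"
  by (simp add: flatten_def unflatten_def vec_eq_iff)

lemma unflatten_flatten [simp]: "unflatten (flatten X) = X"
  by (simp add: flatten_def unflatten_def vec_eq_iff)

lemma flatten_inject: "flatten X = flatten Y \<longleftrightarrow> X = Y"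
  by (metis unflatten_flatten)

lemma flatten_cscale: "flatten (cscale c X) = c *s flatten X"
  by (simp add: flatten_def vec_eq_iff)

lemma flatten_add: "flatten (X + Y) = flatten X + flatten Y"
  by (simp add: flatten_def vec_eq_iff)

lemma flatten_zero: "flatten 0 = 0"
  by (simp add: flatten_def vec_eq_iff)

lemma flatten_sum: "flatten (\<Sum>i\<in>I. f i) = (\<Sum>i\<in>I. flatten (f i))"
  by (induction I rule: infinite_finite_induct) (simp_all add: flatten_add flatten_zero)

lemma cinner_flatten: "cinner (flatten X) (flatten Y) = trace (dagger X ** Y)"
proof -
  have "cinner (flatten X) (flatten Y) = (\<Sum>i\<in>UNIV. \<Sum>j\<in>UNIV. cnj (X $ i $ j) * Y $ i $ j)"
    by (simp add: cinner_def flatten_def sum.cartesian_product' flip: UNIV_Times_UNIV)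
  then show ?thesis by (subst (asm) sum.swap) (simp add: trace_def matrix_matrix_mult_def)
qed

text \<open>Cutting \<open>X\<close> by the projections onto the irreducible summands gives blocks
  that vanish between inequivalent summands and are multiples of one fixed matrix between equivalent
  ones.\<close>

lemma irrep_decomposition_commutant_span:
  fixes G :: "(complex^'n^'n) set"
  assumes dagger: "\<And>U. U \<in> G \<Longrightarrow> dagger U \<in> G" and dec: "irrep_decomposition G k m d"
  obtains S where "finite S" "card S \<le> (\<Sum>i=1..k. (m i)\<^sup>2)" "flatten ` commutant G \<subseteq> vec.span S"
proof -
  interpret dagger_closed_set G using dagger by unfold_locales
  obtain W where W: "\<forall>i\<in>{1..k}. \<forall>j\<in>{1..m i}. irreducible_subspace G (W i j) \<and> vec.dim (W i j) = d i"
    "\<forall>i\<in>{1..k}. \<forall>j\<in>{1..m i}. \<forall>i'\<in>{1..k}. \<forall>j'\<in>{1..m i'}.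
      equivalent_reps G (W i j) (W i' j') \<longleftrightarrow> i = i'"
    "\<forall>i\<in>{1..k}. \<forall>j\<in>{1..m i}. \<forall>i'\<in>{1..k}. \<forall>j'\<in>{1..m i'}.
      (i, j) \<noteq> (i', j') \<longrightarrow> (\<forall>x\<in>W i j. \<forall>y\<in>W i' j'. cinner x y = 0)"
    and span: "vec.span (\<Union>i\<in>{1..k}. \<Union>j\<in>{1..m i}. W i j) = UNIV"
    using dec unfolding irrep_decomposition_def by - (elim conjE exE, rule that)
  have irr: "irreducible_subspace G (W i j)" if "i \<in> {1..k}" "j \<in> {1..m i}" for i j
    using W(1) that by blast
  have eqv: "equivalent_reps G (W i j) (W i' j') \<longleftrightarrow> i = i'"
    if "i \<in> {1..k}" "j \<in> {1..m i}" "i' \<in> {1..k}" "j' \<in> {1..m i'}" for i j i' j'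
    using W(2) that by blast
  have orth: "cinner x y = 0" if "i \<in> {1..k}" "j \<in> {1..m i}" "i' \<in> {1..k}" "j' \<in> {1..m i'}"
    "(i, j) \<noteq> (i', j')" "x \<in> W i j" "y \<in> W i' j'" for i j i' j' x y
    using W(3) that by blast
  define I where "I = (SIGMA i:{1..k}. {1..m i})"
  define V where "V p = W (fst p) (snd p)" for p
  have irrV: "irreducible_subspace G (V p)" if "p \<in> I" for p
    using that irr by (auto simp: I_def V_def)
  have "\<exists>P. projects_onto P (V p)" if "p \<in> I" for p
    using irrV[OF that] exists_projection
    by (metis irreducible_subspace_def invariant_subspace_def)
  then obtain P where P: "\<And>p. p \<in> I \<Longrightarrow> projects_onto (P p) (V p)" by metis
  have finI: "finite I" by (simp add: I_def)
  \<comment> \<open>For \<open>p\<close> different from \<open>q\<close>, moving \<open>P p\<close>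
    across the inner product pairs a vector of \<open>V p\<close> with one of \<open>V q\<close>,
    and these are orthogonal.\<close>
  have PV: "P p *v x = of_bool (p = q) *s x" if "p \<in> I" "q \<in> I" "x \<in> V q" for p q x
  proof (cases "p = q")
    case True
    then show ?thesis using P[OF that(2)] that(3) by (simp add: projects_onto_def)
  next
    case False
    have "cinner (P p *v x) (P p *v x) = cinner (P p *v (P p *v x)) x"
      using P[OF that(1)] by (simp add: cinner_matrix_left projects_onto_def)
    also have "\<dots> = 0"
      using orth[of "fst p" "snd p" "fst q" "snd q" "P p *v (P p *v x)" x] that False P[OF that(1)]
      by (auto simp: I_def V_def projects_onto_def prod_eq_iff)
    finally show ?thesis using False by simp
  qed
  \<comment> \<open>The vectors fixed by the sum form a subspace containing every summand, hence the
    whole space.\<close>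
  have one: "(\<Sum>p\<in>I. P p) = mat 1"
  proof -
    let ?F = "{x. (\<Sum>p\<in>I. P p) *v x = x}"
    have "vec.subspace ?F" by (auto simp: vec.subspace_def matrix_vector_right_distrib vec.scale)
    have "(\<Union>i\<in>{1..k}. \<Union>j\<in>{1..m i}. W i j) \<subseteq> ?F"
    proof clarify
      fix i j x assume "i \<in> {1..k}" "j \<in> {1..m i}" "x \<in> W i j"
      then have q: "(i, j) \<in> I" "x \<in> V (i, j)" by (auto simp: I_def V_def)
      have "(\<Sum>p\<in>I. P p) *v x = (\<Sum>p\<in>I. if p = (i, j) then x else 0)"
        unfolding matrix_sum_vector_mult using PV[OF _ q] by (intro sum.cong) auto
      then show "(\<Sum>p\<in>I. P p) *v x = x" using q finI by simp
    qed
    from vec.span_minimal[OF this \<open>vec.subspace ?F\<close>] have "UNIV \<subseteq> ?F" by (simp only: span)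
    then show ?thesis by (auto simp: matrix_eq)
  qed
  have PG: "P p \<in> commutant G" if "p \<in> I" for p
    using projection_in_commutant irrV[OF that] P[OF that] irreducible_subspace_def by blast
  \<comment> \<open>One generator for each ordered pair of copies within class \<open>i\<close>,
    which is where the squares of the multiplicities come from.\<close>
  define J where "J = (SIGMA i:{1..k}. {1..m i} \<times> {1..m i})"
  have "\<forall>t\<in>J. \<exists>C. \<forall>Y. Y \<in> commutant G \<and> P (fst t, fst (snd t)) ** Y = Y
      \<and> Y ** P (fst t, snd (snd t)) = Y \<longrightarrow> (\<exists>c. Y = cscale c C)"
    using schur_one_dimensional[OF irrV P irrV P] by (auto simp: J_def I_def)
  then obtain C where C: "\<And>t Y. t \<in> J \<Longrightarrow> Y \<in> commutant G \<Longrightarrow> P (fst t, fst (snd t)) ** Y = Y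
      \<Longrightarrow> Y ** P (fst t, snd (snd t)) = Y \<Longrightarrow> \<exists>c. Y = cscale c (C t)" by metis
  let ?S = "flatten ` C ` J"
  have finJ: "finite J" by (simp add: J_def)
  have block: "flatten (P p ** X ** P q) \<in> vec.span ?S" if X: "X \<in> commutant G" and pq: "p \<in> I" "q \<in> I" for X p q
  proof -
    let ?Y = "P p ** X ** P q"
    have Y: "?Y \<in> commutant G" using X PG pq by (intro commutant_closed)
    have Pl: "P p ** ?Y = ?Y" by (simp add: matrix_mul_assoc projects_onto_idem[OF P[OF pq(1)]])
    have Pr: "?Y ** P q = ?Y" using projects_onto_idem[OF P[OF pq(2)]] by (simp flip: matrix_mul_assoc)
    show ?thesis
    proof (cases "?Y = 0")
      case True
      then show ?thesis by (simp add: flatten_zero vec.span_zero)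
    next
      case False
      then have "equivalent_reps G (V q) (V p)"
        using schur_equivalent[OF irrV[OF pq(1)] P[OF pq(1)] irrV[OF pq(2)] P[OF pq(2)] Y Pl Pr] by blast
      then have "fst q = fst p" using eqv pq by (auto simp: I_def V_def)
      then have "(fst p, snd p, snd q) \<in> J" "P (fst p, snd q) = P q"
        using pq by (auto simp: I_def J_def prod_eq_iff)
      then obtain c where "?Y = cscale c (C (fst p, snd p, snd q))"
        using C[of "(fst p, snd p, snd q)" ?Y] Y Pl Pr by auto
      then show ?thesis
        using \<open>(fst p, snd p, snd q) \<in> J\<close> by (simp add: flatten_cscale vec.span_scale vec.span_base)
    qed
  qed
  have "flatten ` commutant G \<subseteq> vec.span ?S"
  proof
    fix x assume "x \<in> flatten ` commutant G"
    then obtain X where X: "X \<in> commutant G" "x = flatten X" by blast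
    have "X = (\<Sum>p\<in>I. P p) ** X ** (\<Sum>q\<in>I. P q)" by (simp add: one)
    also have "\<dots> = (\<Sum>p\<in>I. \<Sum>q\<in>I. P p ** X ** P q)"
      by (simp add: sum_matrix_mult matrix_mult_sum) (rule sum.swap)
    finally have "x = (\<Sum>p\<in>I. \<Sum>q\<in>I. flatten (P p ** X ** P q))"
      unfolding X(2) by (simp flip: flatten_sum)
    then show "x \<in> vec.span ?S" using block[OF X(1)] by (simp add: vec.span_sum)
  qed
  moreover have "card ?S \<le> card J"
    using card_image_le[of J C] card_image_le[of "C ` J" flatten] finJ by simp
  moreover have "card J = (\<Sum>i=1..k. (m i)\<^sup>2)"
    by (simp add: J_def card_SigmaI power2_eq_square)
  ultimately show thesis using that[of ?S] finJ by simp
qed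

context matrix_star_algebra
begin

text \<open>The pairing involves no adjoint, so dualising exchanges \<open>X\<close> and
  \<open>dagger X\<close> in the formula for \<open>proj\<close>. The resulting \<open>D\<close> is
  idempotent by orthonormality, hence its own ergodic projection, and dualising again returns
  \<open>proj\<close>.\<close>

lemma hs_dual_ergodic_projection:
  "hs_dual (ergodic_projection (hs_dual proj)) = proj"
proof -
  define D where "D M = (\<Sum>X\<in>B. cscale (trace (X ** M)) (dagger X))" for M
  have "hs_dual proj = D"
  proof (rule hs_dual_eqI)
    fix M N
    show "trace (D M ** N) = trace (M ** proj N)"
      by (simp add: D_def proj_def sum_matrix_mult matrix_mult_sum cscale_mult_left
          cscale_mult_right trace_sum trace_cscale trace_mul_sym[of M] mult.commute)
  qed
  moreover have "D (D M) = D M" for M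
  proof -
    have "trace (X ** D M) = trace (X ** M)" if "X \<in> B" for X
    proof -
      have "trace (X ** D M) = (\<Sum>Y\<in>B. trace (Y ** M) * of_bool (Y = X))"
        unfolding D_def matrix_mult_sum trace_sum cscale_mult_right trace_cscale
        using basis_orthonormal that by (intro sum.cong) (simp_all add: trace_mul_sym[of X])
      then show ?thesis using that finite_basis by (simp add: sum_mult_of_bool_eq)
    qed
    then show ?thesis by (subst (1 3) D_def) simp
  qed
  moreover have "hs_dual D = proj"
  proof (rule hs_dual_eqI)
    fix M N
    show "trace (proj M ** N) = trace (M ** D N)"
      by (simp add: D_def proj_def sum_matrix_mult matrix_mult_sum cscale_mult_left
          cscale_mult_right trace_sum trace_cscale trace_mul_sym[of M] mult.commute)
  qed
  ultimately show ?thesis by (simp add: ergodic_projection_idempotent)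
qed

end

text \<open>An orthonormal basis of the flattened commutant, read back as matrices; its size is the
  dimension, which a spanning set bounds.\<close>

lemma commutant_star_algebra_basis:
  fixes G :: "(complex^'n^'n) set"
  assumes dagger: "\<And>U. U \<in> G \<Longrightarrow> dagger U \<in> G"
    and S: "finite S" "flatten ` commutant G \<subseteq> vec.span S"
  obtains B where "matrix_star_algebra (commutant G) B" "card B \<le> card S"
proof -
  have "vec.subspace (flatten ` commutant G)"
    unfolding vec.subspace_def
    by (auto simp flip: flatten_zero flatten_add flatten_cscale intro!: imageI commutant_closed)
  then obtain F where F: "orthonormal_set F" "F \<subseteq> flatten ` commutant G" "vec.span F = flatten ` commutant G"
    by (rule exists_orthonormal_basis)
  have inj: "inj_on unflatten F" by (metis flatten_unflatten inj_onI)
  have "matrix_star_algebra (commutant G) (unflatten ` F)"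
  proof
    show "finite (unflatten ` F)" using orthonormal_set_finite[OF F(1)] by simp
    show "unflatten ` F \<subseteq> commutant G" using F(2) by force
    show "(\<Sum>X\<in>unflatten ` F. cscale (trace (dagger X ** Y)) X) = Y" if "Y \<in> commutant G" for Y
    proof -
      have "flatten (\<Sum>X\<in>unflatten ` F. cscale (trace (dagger X ** Y)) X) = (\<Sum>b\<in>F. cinner b (flatten Y) *s b)"
        by (simp add: sum.reindex[OF inj] flatten_sum flatten_cscale flip: cinner_flatten)
      also have "\<dots> = flatten Y" using F that by (intro orthonormal_set_expansion) auto
      finally show ?thesis by (simp only: flatten_inject)
    qed
    show "trace (dagger X ** Y) = of_bool (X = Y)" if "X \<in> unflatten ` F" "Y \<in> unflatten ` F" for X Y
    proof -
      have "flatten X \<in> F" "flatten Y \<in> F" using that by auto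
      then have "trace (dagger X ** Y) = of_bool (flatten Y = flatten X)"
        using orthonormal_setD[OF F(1)] by (simp flip: cinner_flatten)
      then show ?thesis by (simp add: flatten_inject eq_commute[of Y])
    qed
  qed (auto intro: commutant_closed commutant_dagger dagger)
  moreover have "card (unflatten ` F) \<le> card S"
  proof -
    have "card (unflatten ` F) = vec.dim F"
      using card_image[OF inj] vec.dim_eq_card_independent[OF orthonormal_set_independent[OF F(1)]] by simp
    also have "\<dots> \<le> card S" using F(2) S by (intro vec.dim_le_card) auto
    finally show ?thesis .
  qed
  ultimately show thesis using that by blast
qed

theorem corollary4p7:
  fixes \<V> :: "(complex^'n^'n) set"
    and \<mu> :: "(complex^'n^'n) measure"
    and k :: nat
    and m d :: "nat \<Rightarrow> nat"
  assumes "compact_unitary_group \<V>"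
    and "normalized_haar_measure \<V> \<mu>"
    and "irrep_decomposition \<V> k m d"
    and "CARD('n) \<le> CARD('r::finite)"
  shows "ea_capacity TYPE('r) (hs_dual (conditional_expectation_onto_commutant \<mu>))
           \<le> ereal (log 2 (\<Sum>i=1..k. (real (m i))\<^sup>2))"
proof -
  interpret haar_average \<V> \<mu> using assms(1,2) by unfold_locales
  obtain S where S: "finite S" "card S \<le> (\<Sum>i=1..k. (m i)\<^sup>2)" "flatten ` commutant \<V> \<subseteq> vec.span S"
    using irrep_decomposition_commutant_span[OF group_simps(4) assms(3)] by blast
  obtain B where B: "matrix_star_algebra (commutant \<V>) B" "card B \<le> card S"
    using commutant_star_algebra_basis[OF group_simps(4) S(1,3)] by blast
  interpret matrix_star_algebra "commutant \<V>" B by (rule B(1))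
  \<comment> \<open>The average lies in the commutant and has the same coefficients against
    \<open>B\<close> as \<open>M\<close>, so it is the projection of \<open>M\<close>.\<close>
  have channel: "group_channel \<mu> = proj"
  proof
    fix M
    have "trace (dagger X ** group_channel \<mu> M) = trace (dagger X ** M)" if "X \<in> B" for X
      using that basis_subset by (intro trace_mult_group_channel dagger_closed) auto
    then have "proj M = proj (group_channel \<mu> M)" by (simp add: proj_def)
    also have "\<dots> = group_channel \<mu> M"
      unfolding proj_def by (rule basis_expansion[OF group_channel_in_commutant])
    finally show "group_channel \<mu> M = proj M" by simp
  qed
  \<comment> \<open>For empty \<open>B\<close> the projection would be 0, yet it preserves the
    nonzero trace of the identity. Monotonicity of \<open>log 2\<close> needs \<open>card B\<close>
    positive.\<close>
  have "B \<noteq> {}" using trace_mult_proj[OF one_closed, of "mat 1"] by (auto simp: proj_def trace_I trace_0[unfolded mat_0])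
  then have "card B > 0" using finite_basis by (simp add: card_gt_0_iff)
  moreover have "real (card B) \<le> (\<Sum>i=1..k. (real (m i))\<^sup>2)"
    using B(2) S(2) by (simp flip: of_nat_power of_nat_sum)
  ultimately have bound: "log 2 (card B) \<le> log 2 (\<Sum>i=1..k. (real (m i))\<^sup>2)" by simp
  show ?thesis
    unfolding ea_capacity_def conditional_expectation_onto_commutant_def channel
      hs_dual_ergodic_projection
  proof (rule Sup_least, clarify)
    fix \<rho> :: "complex^'n^'n" and \<psi> :: "complex^('r \<times> 'n)"
    assume "density_operator \<rho>" "purification \<psi> \<rho>"
    then have "trace (reduced_A (pure_state \<psi>)) = 1"
      by (simp add: density_operator_def purification_def)
    then have "Defs.mutual_information (id_tensor proj (pure_state \<psi>)) \<le> ereal (log 2 (card B))"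
      using id_tensor_group_channel_psd[of \<psi>] unfolding channel by (intro mutual_information_le)
    also have "\<dots> \<le> ereal (log 2 (\<Sum>i=1..k. (real (m i))\<^sup>2))" using bound by simp
    finally show "Defs.mutual_information (id_tensor proj (pure_state \<psi>))
        \<le> ereal (log 2 (\<Sum>i=1..k. (real (m i))\<^sup>2))" .
  qed
qed

end
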